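(* Let $\mathcal{S}$ be a commutative semiring with $0$ and $1$, let $n$ be a natural number ($n\ge 1$) and let $\Sigma$ be a (not necessarily finite) alphabet. Let $\rho : \Sigma^* \to \overline{\mathcal{S}[X_{n,\Sigma}]}\,\Gamma_{n,\Sigma}$ be the map $w \mapsto \sum_{\pi} f_\pi^w\, \pi$ defined in the context. Then $\rho(\Sigma^* )$ [respectively, $\rho(\Sigma^+)$] is a multiplicative submonoid [respectively, subsemigroup] of the quiver algebra $\overline{\mathcal{S}[X_{n,\Sigma}]}\,\Gamma_{n,\Sigma}$ which is free of rank $|\Sigma|$, freely generated by the elements $\rho(\sigma)$ for $\sigma\in\Sigma$, in the monoid variety [respectively, semigroup variety] generated by $UT_n(\mathcal{S})$.
   Context: Semirings have associative operations $+$ and $\times$, with $+$ commutative, $\times$ distributing over $+$, $0\neq 1$, $1$ a multiplicative identity, and $0$ an additive identity and multiplicative zero; commutative means multiplication is commutative. $UT_n(\mathcal{S})$ is the monoid of $n\times n$ upper triangular matrices over $\mathcal{S}$ under matrix multiplication. $\Sigma^*$ (resp. $\Sigma^+$) is the free monoid (resp. free semigroup) on $\Sigma$. A family of generators freely generates an object $F$ of a variety if $F$ is in the variety and every function from the generators to a member $M$ of the variety extends uniquely to a morphism $F\to M$. Polynomial functions: for a set $X$ of commuting variables, $\mathcal{S}[X]$ is the semiring of formal polynomials over $\mathcal{S}$ (each involving finitely many variables). Each $f\in\mathcal{S}[X]$ has an evaluation function $\mathcal{S}^X\to\mathcal{S}$; $\overline{\mathcal{S}[X]}$ is the commutative semiring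 of these evaluation functions, i.e. the quotient of $\mathcal{S}[X]$ identifying formal polynomials with the same evaluation function. Quiver algebras: a quiver is a directed graph, acyclic except perhaps for loops, possibly with loops and multiple edges. Paths are finite composable sequences of edges, including a distinct empty path $\langle v\rangle$ at each vertex $v$; $\Gamma^*$ is the set of all paths of $\Gamma$. For a commutative semiring $R$, the quiver algebra $R\Gamma$ is the set of finitely supported functions $\Gamma^*\to R$ with pointwise addition and multiplication $(fg)(x)=\sum_{st=x} f(s)g(t)$, where $st$ is concatenation of paths. Elements are written as formal $R$-linear combinations of paths; the multiplicative identity is the sum of all empty paths. The map $\rho$: write $[n]=\{1,\dots,n\}$ and $X_{n,\Sigma}=\{\sigma_v \mid \sigma\in\Sigma, v\in[n]\}$ (formal variables). $\Gamma^0_{n,\Sigma}$ is the quiver with vertex set $[n]$ and, for each $i\le j$ and each $\sigma\in\Sigma$, exactly one edge from $i$ to $j$ labelled $\sigma$; $\Gamma_{n,\Sigma}$ is obtained from it by removing all loops. Paths are labelled by words in $\Sigma^*$. For $w\in\Sigma^*$ and a path $\pi$ in $\Gamma_{n,\Sigma}$, a $\pi$-$w$-amble is a path in $\Gamma^0_{n,\Sigma}$ with label $w$ such that removing its loop edges yields $\pi$. For a $\pi$-$w$-amble $\tau$, its corresponding monomial is $\mu_\tau=\prod_{i=1}^{|\tau|}x_i\in\overline{\mathcal{S}[X_{n,\Sigma}]}$, where $x_i=1$ if the $i$th edge of $\tau$ is not a loop, and $x_i=\sigma_v$ if the $i$th edge of $\tau$ is a loop at $v$ labelled $\sigma$ (the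 empty product is $1$). Set $f_\pi^w=\sum_\tau \mu_\tau\in\overline{\mathcal{S}[X_{n,\Sigma}]}$, the sum being over all $\pi$-$w$-ambles $\tau$ (the empty sum is $0$). Then $\rho(w)=\sum_\pi f_\pi^w\,\pi$, the sum being over all paths $\pi$ in $\Gamma_{n,\Sigma}$. In particular $\rho(\sigma)$ is the sum of all length-$1$ paths labelled $\sigma$ plus $\sum_{v\in[n]}\sigma_v\langle v\rangle$. *)

theory Defs
  imports
    "HOL-Algebra.Ring"
    "HOL-Library.Poly_Mapping"
    "Graph_Theory.Arc_Walk"
    "Jordan_Normal_Form.Matrix"
begin

section \<open>Varieties of monoids and of semigroups\<close>

text \<open>Semigroups are represented by the record type of monoids, with the field \<^const>\<open>one\<close>
  ignored. A semigroup may be empty.\<close>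

definition is_semigroup :: "('a, 'b) monoid_scheme \<Rightarrow> bool" where
  "is_semigroup M \<longleftrightarrow>
    (\<forall>x\<in>carrier M. \<forall>y\<in>carrier M. x \<otimes>\<^bsub>M\<^esub> y \<in> carrier M) \<and>
    (\<forall>x\<in>carrier M. \<forall>y\<in>carrier M. \<forall>z\<in>carrier M.
      (x \<otimes>\<^bsub>M\<^esub> y) \<otimes>\<^bsub>M\<^esub> z = x \<otimes>\<^bsub>M\<^esub> (y \<otimes>\<^bsub>M\<^esub> z))"

definition subsemigroup :: "'a set \<Rightarrow> ('a, 'b) monoid_scheme \<Rightarrow> bool" where
  "subsemigroup H M \<longleftrightarrow> H \<subseteq> carrier M \<and> (\<forall>x\<in>H. \<forall>y\<in>H. x \<otimes>\<^bsub>M\<^esub> y \<in> H)"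

definition monoid_homs :: "('a, 'c) monoid_scheme \<Rightarrow> ('b, 'd) monoid_scheme \<Rightarrow> ('a \<Rightarrow> 'b) set" where
  "monoid_homs M N = {h \<in> hom M N. h \<one>\<^bsub>M\<^esub> = \<one>\<^bsub>N\<^esub>}"

definition free_monoid :: "'x set \<Rightarrow> 'x list monoid" where
  "free_monoid X = \<lparr>carrier = lists X, mult = (@), one = []\<rparr>"

definition free_semigroup :: "'x set \<Rightarrow> 'x list monoid" where
  "free_semigroup X = (free_monoid X)\<lparr>carrier := lists X - {[]}\<rparr>"

text \<open>Identities are pairs of words over a countably infinite alphabet, here \<^typ>\<open>nat\<close>. A variety is
  the class of all monoids (or semigroups) satisfying a given set of identities, and the variety
  generated by \<open>U\<close> is the least variety containing \<open>U\<close>; only the membership predicate of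
  these classes can be expressed.\<close>

definition monoid_variety :: "(nat list \<times> nat list) set \<Rightarrow> ('a, 'b) monoid_scheme \<Rightarrow> bool" where
  "monoid_variety E M \<longleftrightarrow> monoid M \<and>
    (\<forall>(u, v)\<in>E. \<forall>h\<in>monoid_homs (free_monoid UNIV) M. h u = h v)"

definition semigroup_variety :: "(nat list \<times> nat list) set \<Rightarrow> ('a, 'b) monoid_scheme \<Rightarrow> bool" where
  "semigroup_variety E M \<longleftrightarrow> is_semigroup M \<and>
    (\<forall>(u, v)\<in>E. \<forall>h\<in>hom (free_semigroup UNIV) M. h u = h v)"

definition in_generated_monoid_variety ::
    "('u, 'v) monoid_scheme \<Rightarrow> ('a, 'b) monoid_scheme \<Rightarrow> bool" where
  "in_generated_monoid_variety U M \<longleftrightarrow>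
    (\<forall>E. monoid_variety E U \<longrightarrow> monoid_variety E M)"

definition in_generated_semigroup_variety ::
    "('u, 'v) monoid_scheme \<Rightarrow> ('a, 'b) monoid_scheme \<Rightarrow> bool" where
  "in_generated_semigroup_variety U M \<longleftrightarrow>
    (\<forall>E \<subseteq> carrier (free_semigroup UNIV) \<times> carrier (free_semigroup UNIV).
      semigroup_variety E U \<longrightarrow> semigroup_variety E M)"

text \<open>The family \<open>g\<close>, indexed by \<open>I\<close>, freely generates \<open>F\<close> in the variety generated by \<open>U\<close>. The
  universal property is tested on the members of the variety whose elements have type \<open>'m\<close>; a
  theorem with \<open>'m\<close> a type variable covers all of them. Morphisms are taken extensional on
  the carrier of \<open>F\<close>, so that uniqueness is uniqueness on that carrier.\<close>

definition freely_generates_monoid ::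
    "'m itself \<Rightarrow> ('u, 'v) monoid_scheme \<Rightarrow> ('f, 'b) monoid_scheme \<Rightarrow> 'i set \<Rightarrow> ('i \<Rightarrow> 'f) \<Rightarrow> bool"
  where
  "freely_generates_monoid (_ :: 'm itself) U F I g \<longleftrightarrow>
    in_generated_monoid_variety U F \<and> g ` I \<subseteq> carrier F \<and>
    (\<forall>(M :: 'm monoid) \<phi>. in_generated_monoid_variety U M \<and> \<phi> \<in> I \<rightarrow> carrier M \<longrightarrow>
      (\<exists>!h. h \<in> extensional (carrier F) \<and> h \<in> monoid_homs F M \<and> (\<forall>i\<in>I. h (g i) = \<phi> i)))"

definition freely_generates_semigroup ::
    "'m itself \<Rightarrow> ('u, 'v) monoid_scheme \<Rightarrow> ('f, 'b) monoid_scheme \<Rightarrow> 'i set \<Rightarrow> ('i \<Rightarrow> 'f) \<Rightarrow> bool"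
  where
  "freely_generates_semigroup (_ :: 'm itself) U F I g \<longleftrightarrow>
    in_generated_semigroup_variety U F \<and> g ` I \<subseteq> carrier F \<and>
    (\<forall>(M :: 'm monoid) \<phi>. in_generated_semigroup_variety U M \<and> \<phi> \<in> I \<rightarrow> carrier M \<longrightarrow>
      (\<exists>!h. h \<in> extensional (carrier F) \<and> h \<in> hom F M \<and> (\<forall>i\<in>I. h (g i) = \<phi> i)))"


section \<open>Upper triangular matrices\<close>

definition UT :: "'a itself \<Rightarrow> nat \<Rightarrow> 'a :: comm_semiring_1 mat monoid" where
  "UT _ n = \<lparr>carrier = {A \<in> carrier_mat n n. upper_triangular A}, mult = (*), one = 1\<^sub>m n\<rparr>"


section \<open>Semirings of polynomial functions\<close>

text \<open>A formal polynomial is a finitely supported function from monomials to coefficients, and a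
  monomial is a finitely supported function from variables to exponents.\<close>

definition polynomials :: "'x set \<Rightarrow> (('x \<Rightarrow>\<^sub>0 nat) \<Rightarrow>\<^sub>0 'a :: comm_semiring_1) set" where
  "polynomials X = {p. \<forall>m\<in>Poly_Mapping.keys p. Poly_Mapping.keys m \<subseteq> X}"

definition poly_eval ::
    "(('x \<Rightarrow>\<^sub>0 nat) \<Rightarrow>\<^sub>0 'a :: comm_semiring_1) \<Rightarrow> ('x \<Rightarrow> 'a) \<Rightarrow> 'a" where
  "poly_eval p a =
    (\<Sum>m\<in>Poly_Mapping.keys p. Poly_Mapping.lookup p m *
      (\<Prod>x\<in>Poly_Mapping.keys m. a x ^ Poly_Mapping.lookup m x))"

text \<open>Assignments are total functions on the type of variables; a polynomial over \<open>X\<close> does not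
  depend on the values outside \<open>X\<close>, so its evaluation function on assignments
  \<open>X \<rightarrow> S\<close> is faithfully represented.\<close>

definition polyfun_semiring ::
    "'a itself \<Rightarrow> 'x set \<Rightarrow> (('x \<Rightarrow> 'a :: comm_semiring_1) \<Rightarrow> 'a) ring" where
  "polyfun_semiring _ X =
    \<lparr>carrier = poly_eval ` polynomials X,
     mult = (\<lambda>f g a. f a * g a), one = (\<lambda>a. 1),
     zero = (\<lambda>a. 0), add = (\<lambda>f g a. f a + g a)\<rparr>"


section \<open>Quiver algebras\<close>

text \<open>A path is a start vertex with a list of arcs; the start vertex is needed for empty paths
  only and is otherwise the tail of the first arc.\<close>

type_synonym ('v, 'e) path = "'v \<times> 'e list"

definition paths :: "('v, 'e) pre_digraph \<Rightarrow> ('v, 'e) path set" where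
  "paths G = {(u, p). \<exists>v. pre_digraph.awalk G u p v}"

definition path_end :: "('v, 'e) pre_digraph \<Rightarrow> ('v, 'e) path \<Rightarrow> 'v" where
  "path_end G s = pre_digraph.awlast G (fst s) (snd s)"

definition factorizations ::
    "('v, 'e) pre_digraph \<Rightarrow> ('v, 'e) path \<Rightarrow> (('v, 'e) path \<times> ('v, 'e) path) set" where
  "factorizations G x = {(s, t). s \<in> paths G \<and> t \<in> paths G \<and> path_end G s = fst t \<and>
    (fst s, snd s @ snd t) = x}"

text \<open>The unit is the sum of all empty paths, so it lies in the carrier for quivers with finitely
  many vertices.\<close>

definition quiver_algebra ::
    "('r, 'b) ring_scheme \<Rightarrow> ('v, 'e) pre_digraph \<Rightarrow> (('v, 'e) path \<Rightarrow> 'r) ring" where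
  "quiver_algebra R G =
    \<lparr>carrier = {f. (\<forall>x\<in>paths G. f x \<in> carrier R) \<and> (\<forall>x. x \<notin> paths G \<longrightarrow> f x = \<zero>\<^bsub>R\<^esub>) \<and>
                   finite {x. f x \<noteq> \<zero>\<^bsub>R\<^esub>}},
     mult = (\<lambda>f g x. \<Oplus>\<^bsub>R\<^esub>st\<in>factorizations G x. f (fst st) \<otimes>\<^bsub>R\<^esub> g (snd st)),
     one = (\<lambda>(u, p). if u \<in> verts G \<and> p = [] then \<one>\<^bsub>R\<^esub> else \<zero>\<^bsub>R\<^esub>),
     zero = (\<lambda>x. \<zero>\<^bsub>R\<^esub>),
     add = (\<lambda>f g x. f x \<oplus>\<^bsub>R\<^esub> g x)\<rparr>"


section \<open>The map \<open>\<rho>\<close>\<close>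

text \<open>The arc \<open>(i, \<sigma>, j)\<close> goes from \<open>i\<close> to \<open>j\<close> and is labelled \<open>\<sigma>\<close>; the variable \<open>\<sigma>\<^sub>v\<close> is the
  pair \<open>(\<sigma>, v)\<close>.\<close>

type_synonym 's arc = "nat \<times> 's \<times> nat"

definition arc_label :: "'s arc \<Rightarrow> 's" where
  "arc_label e = fst (snd e)"

definition variables :: "nat \<Rightarrow> 's set \<Rightarrow> ('s \<times> nat) set" where
  "variables n \<Sigma> = \<Sigma> \<times> {1..n}"

definition Gamma0 :: "nat \<Rightarrow> 's set \<Rightarrow> (nat, 's arc) pre_digraph" where
  "Gamma0 n \<Sigma> =
    \<lparr>verts = {1..n},
     arcs = {(i, \<sigma>, j). i \<in> {1..n} \<and> j \<in> {1..n} \<and> i \<le> j \<and> \<sigma> \<in> \<Sigma>},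
     tail = fst, head = (\<lambda>e. snd (snd e))\<rparr>"

definition is_loop :: "'s arc \<Rightarrow> bool" where
  "is_loop e \<longleftrightarrow> fst e = snd (snd e)"

definition Gamma :: "nat \<Rightarrow> 's set \<Rightarrow> (nat, 's arc) pre_digraph" where
  "Gamma n \<Sigma> = (Gamma0 n \<Sigma>)\<lparr>arcs := {e \<in> arcs (Gamma0 n \<Sigma>). \<not> is_loop e}\<rparr>"

definition path_label :: "(nat, 's arc) path \<Rightarrow> 's list" where
  "path_label \<tau> = map arc_label (snd \<tau>)"

definition remove_loops :: "(nat, 's arc) path \<Rightarrow> (nat, 's arc) path" where
  "remove_loops \<tau> = (fst \<tau>, filter (\<lambda>e. \<not> is_loop e) (snd \<tau>))"

definition ambles :: "nat \<Rightarrow> 's set \<Rightarrow> (nat, 's arc) path \<Rightarrow> 's list \<Rightarrow> (nat, 's arc) path set" where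
  "ambles n \<Sigma> \<pi> w = {\<tau> \<in> paths (Gamma0 n \<Sigma>). path_label \<tau> = w \<and> remove_loops \<tau> = \<pi>}"

abbreviation coeff_semiring ::
    "'a itself \<Rightarrow> nat \<Rightarrow> 's set \<Rightarrow> (('s \<times> nat \<Rightarrow> 'a :: comm_semiring_1) \<Rightarrow> 'a) ring" where
  "coeff_semiring A n \<Sigma> \<equiv> polyfun_semiring A (variables n \<Sigma>)"

definition arc_factor :: "'s arc \<Rightarrow> ('s \<times> nat \<Rightarrow> 'a :: comm_semiring_1) \<Rightarrow> 'a" where
  "arc_factor e = (if is_loop e then (\<lambda>a. a (arc_label e, fst e)) else (\<lambda>a. 1))"

definition amble_monomial ::
    "'a itself \<Rightarrow> nat \<Rightarrow> 's set \<Rightarrow> (nat, 's arc) path \<Rightarrow>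
      ('s \<times> nat \<Rightarrow> 'a :: comm_semiring_1) \<Rightarrow> 'a" where
  "amble_monomial A n \<Sigma> \<tau> =
    (\<Otimes>\<^bsub>coeff_semiring A n \<Sigma>\<^esub>i\<in>{..<length (snd \<tau>)}. arc_factor (snd \<tau> ! i))"

definition path_coeff ::
    "'a itself \<Rightarrow> nat \<Rightarrow> 's set \<Rightarrow> 's list \<Rightarrow> (nat, 's arc) path \<Rightarrow>
      ('s \<times> nat \<Rightarrow> 'a :: comm_semiring_1) \<Rightarrow> 'a" where
  "path_coeff A n \<Sigma> w \<pi> =
    (\<Oplus>\<^bsub>coeff_semiring A n \<Sigma>\<^esub>\<tau>\<in>ambles n \<Sigma> \<pi> w. amble_monomial A n \<Sigma> \<tau>)"

abbreviation rho_algebra ::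
    "'a itself \<Rightarrow> nat \<Rightarrow> 's set \<Rightarrow>
      ((nat, 's arc) path \<Rightarrow> ('s \<times> nat \<Rightarrow> 'a :: comm_semiring_1) \<Rightarrow> 'a) ring" where
  "rho_algebra A n \<Sigma> \<equiv> quiver_algebra (coeff_semiring A n \<Sigma>) (Gamma n \<Sigma>)"

definition rho ::
    "'a itself \<Rightarrow> nat \<Rightarrow> 's set \<Rightarrow> 's list \<Rightarrow>
      (nat, 's arc) path \<Rightarrow> ('s \<times> nat \<Rightarrow> 'a :: comm_semiring_1) \<Rightarrow> 'a" where
  "rho A n \<Sigma> w = (\<lambda>\<pi>. if \<pi> \<in> paths (Gamma n \<Sigma>) then path_coeff A n \<Sigma> w \<pi>
    else \<zero>\<^bsub>coeff_semiring A n \<Sigma>\<^esub>)"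

end

theory Submission
  imports Defs
begin

text \<open>
  The free object on \<open>\<Sigma>\<close> in the variety generated by \<open>U\<close> is the quotient of \<open>\<Sigma>\<^sup>*\<close> by the
  congruence that identifies \<open>u\<close> with \<open>v\<close> when \<open>u = v\<close> is a law of \<open>U\<close>, that is, when every
  substitution of elements of \<open>U\<close> for the letters gives both words the same value. Hence it suffices
  that \<open>\<rho>\<close> is a homomorphism (\<open>rho_append\<close>, \<open>rho_Nil\<close>) whose kernel is the set of laws of
  \<open>UT\<^sub>n\<close> (\<open>rho_eq_iff_law_of_UT\<close>). The step from the kernel to freeness is the same for every
  monoid \<open>U\<close> (\<open>freely_generates_monoid_if_kernel_is_laws\<close> and its semigroup version). Its only
  subtlety is that varieties are defined by identities over a countable alphabet, whereas \<open>\<Sigma>\<close> is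
  arbitrary; since an identity involves finitely many letters, it can be renamed.

  Both facts about \<open>\<rho>\<close> rest on a recursion for the coefficient \<open>f\<close> of a path \<open>\<pi>\<close> in \<open>\<rho>(\<sigma>w)\<close>:
  the first edge of an amble is either a loop at the start \<open>i\<close> of \<open>\<pi>\<close>, which contributes the
  variable \<open>\<sigma>\<^sub>i\<close> and leaves an amble for \<open>\<pi>\<close> and \<open>w\<close>, or it is the first edge of \<open>\<pi>\<close>, which must
  then be labelled \<open>\<sigma>\<close>. The function \<open>amble_sum\<close> is this recursion
  (\<open>path_coeff_eq_amble_sum\<close>). Multiplicativity follows by induction: an amble labelled \<open>uv\<close> splits
  uniquely into an amble labelled \<open>u\<close> and one labelled \<open>v\<close>, for the two parts of a factorization of
  \<open>\<pi>\<close>.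

  For the kernel, let a matrix \<open>\<psi>(\<sigma>)\<close> be given for each letter. The \<open>(i, j)\<close> entry of the product of
  the matrices along \<open>w\<close> sums, over all paths from \<open>i\<close> to \<open>j\<close> labelled \<open>w\<close>, the products of the
  entries at the edges. Grouping the paths by what remains after removal of the loops gives
  (\<open>word_prod_UT_entry\<close>) the sum, over the loop-free paths \<open>\<pi>\<close> from \<open>i\<close> to \<open>j\<close>, of the product of the
  entries at the edges of \<open>\<pi>\<close> times the value of the coefficient of \<open>\<pi>\<close> in \<open>\<rho>(w)\<close> at the
  diagonal entries. So \<open>\<rho>(w)\<close> determines all these entries, and words with the same image under \<open>\<rho>\<close>
  form a law of \<open>UT\<^sub>n\<close>. Conversely, given \<open>\<pi>\<close> and an assignment \<open>a\<close> of the variables, put \<open>a\<close> on the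
  diagonals, \<open>1\<close> at the edges of \<open>\<pi>\<close> and \<open>0\<close> elsewhere. A loop-free path is strictly increasing in its
  vertices, so no other path with the same ends uses only edges of \<open>\<pi>\<close>, and the sum collapses to the
  coefficient of \<open>\<pi>\<close> evaluated at \<open>a\<close> (\<open>amble_sum_eq_word_prod_UT_entry\<close>). Thus a law of \<open>UT\<^sub>n\<close>
  forces equality of all coefficients.
\<close>

(* Membership of words in "lists I" is used as an opaque fact that matches the premises of the
   lemmas on words, so automation must not turn it into a quantification over letters. *)
declare in_listsD [rule del] in_listsI [rule del]

section \<open>Laws and free objects\<close>

text \<open>One-letter words have their own clause so that the value of a nonempty word does not mention
  the field \<^const>\<open>one\<close>, which has no meaning in a semigroup.\<close>
fun word_prod :: "('a, 'b) monoid_scheme \<Rightarrow> ('x \<Rightarrow> 'a) \<Rightarrow> 'x list \<Rightarrow> 'a" where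
  "word_prod M \<phi> [] = \<one>\<^bsub>M\<^esub>"
| "word_prod M \<phi> [x] = \<phi> x"
| "word_prod M \<phi> (x # y # w) = \<phi> x \<otimes>\<^bsub>M\<^esub> word_prod M \<phi> (y # w)"

lemma word_prod_Cons:
  "w \<noteq> [] \<Longrightarrow> word_prod M \<phi> (x # w) = \<phi> x \<otimes>\<^bsub>M\<^esub> word_prod M \<phi> w"
  by (cases w) auto

lemma word_prod_cong:
  "(\<And>x. x \<in> set w \<Longrightarrow> \<phi> x = \<psi> x) \<Longrightarrow> word_prod M \<phi> w = word_prod M \<psi> w"
  by (induction M \<phi> w rule: word_prod.induct) auto

lemma word_prod_map: "word_prod M \<phi> (map f w) = word_prod M (\<phi> \<circ> f) w"
  by (induction M "\<phi> \<circ> f" w rule: word_prod.induct) auto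

lemma word_prod_closed_semigroup:
  assumes "is_semigroup M" "\<phi> \<in> I \<rightarrow> carrier M" "w \<in> lists I" "w \<noteq> []"
  shows "word_prod M \<phi> w \<in> carrier M"
  using assms(3,4)
proof (induction w)
  case (Cons x w)
  then show ?case
    using assms(1,2) by (cases "w = []") (auto simp: word_prod_Cons is_semigroup_def)
qed simp

lemma word_prod_append_semigroup:
  assumes "is_semigroup M" "\<phi> \<in> I \<rightarrow> carrier M" "u \<in> lists I" "u \<noteq> []" "v \<in> lists I" "v \<noteq> []"
  shows "word_prod M \<phi> (u @ v) = word_prod M \<phi> u \<otimes>\<^bsub>M\<^esub> word_prod M \<phi> v"
  using assms(3,4)
proof (induction u)
  case (Cons x u)
  show ?case
  proof (cases "u = []")
    case False
    have "x \<in> I" "u \<in> lists I"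
      using Cons.hyps by simp_all
    then have "\<phi> x \<in> carrier M" "word_prod M \<phi> u \<in> carrier M" "word_prod M \<phi> v \<in> carrier M"
      using word_prod_closed_semigroup[OF assms(1,2)] assms(2,5,6) False by auto
    then show ?thesis
      using assms(1) Cons False by (auto simp: word_prod_Cons is_semigroup_def)
  qed (use assms(6) in \<open>simp add: word_prod_Cons\<close>)
qed simp

lemma is_semigroup_if_monoid: "monoid M \<Longrightarrow> is_semigroup M"
  by (simp add: is_semigroup_def monoid.m_assoc monoid.m_closed)

lemma word_prod_Cons_monoid:
  assumes "monoid M" "\<phi> x \<in> carrier M"
  shows "word_prod M \<phi> (x # w) = \<phi> x \<otimes>\<^bsub>M\<^esub> word_prod M \<phi> w"
  using assms by (cases w) (simp_all add: monoid.r_one)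

lemma word_prod_closed_monoid:
  assumes "monoid M" "\<phi> \<in> I \<rightarrow> carrier M" "w \<in> lists I"
  shows "word_prod M \<phi> w \<in> carrier M"
  using word_prod_closed_semigroup[OF is_semigroup_if_monoid[OF assms(1)] assms(2,3)]
    monoid.one_closed[OF assms(1)]
  by (cases "w = []") simp_all

lemma word_prod_append_monoid:
  assumes "monoid M" "\<phi> \<in> I \<rightarrow> carrier M" "u \<in> lists I" "v \<in> lists I"
  shows "word_prod M \<phi> (u @ v) = word_prod M \<phi> u \<otimes>\<^bsub>M\<^esub> word_prod M \<phi> v"
proof -
  have "word_prod M \<phi> u \<in> carrier M" "word_prod M \<phi> v \<in> carrier M"
    using word_prod_closed_monoid[OF assms(1,2)] assms(3,4) by blast+
  then show ?thesis
    using word_prod_append_semigroup[OF is_semigroup_if_monoid[OF assms(1)] assms(2,3) _ assms(4)]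
    by (cases "u = []"; cases "v = []")
      (simp_all add: monoid.l_one[OF assms(1)] monoid.r_one[OF assms(1)])
qed

lemma word_prod_concat_monoid:
  assumes "monoid M" "\<phi> \<in> I \<rightarrow> carrier M" "\<And>x. x \<in> set w \<Longrightarrow> s x \<in> lists I"
  shows "word_prod M \<phi> (concat (map s w)) = word_prod M (\<lambda>x. word_prod M \<phi> (s x)) w"
  using assms(3)
proof (induction w)
  case (Cons x w)
  have "concat (map s w) \<in> lists I"
    using Cons.prems by (force simp: in_lists_conv_set)
  then show ?case
    using Cons word_prod_append_monoid[OF assms(1,2)] word_prod_closed_monoid[OF assms(1,2)]
    by (simp add: word_prod_Cons_monoid[OF assms(1)])
qed simp

text \<open>The morphisms out of the free semigroup are the substitutions of elements for letters; this
  lets identities be discussed without homomorphisms from here on.\<close>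
lemma hom_free_semigroup_iff_word_prod:
  assumes "is_semigroup M"
  shows "h \<in> hom (free_semigroup I) M \<longleftrightarrow>
    (\<exists>\<phi>\<in>I \<rightarrow> carrier M. \<forall>w\<in>lists I - {[]}. h w = word_prod M \<phi> w)"
proof
  assume h: "h \<in> hom (free_semigroup I) M"
  have "h w = word_prod M (\<lambda>x. h [x]) w" if "w \<in> lists I - {[]}" for w
    using that
  proof (induction w)
    case (Cons x w)
    have "h (x # w) = h [x] \<otimes>\<^bsub>M\<^esub> h w" if "w \<noteq> []"
      using hom_mult[OF h, of "[x]" w] Cons.prems that
      by (auto simp: free_semigroup_def free_monoid_def)
    then show ?case
      using Cons by (cases "w = []") (auto simp: word_prod_Cons)
  qed simp
  moreover have "(\<lambda>x. h [x]) \<in> I \<rightarrow> carrier M"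
    using h by (auto simp: hom_def free_semigroup_def free_monoid_def)
  ultimately show "\<exists>\<phi>\<in>I \<rightarrow> carrier M. \<forall>w\<in>lists I - {[]}. h w = word_prod M \<phi> w"
    by blast
next
  assume "\<exists>\<phi>\<in>I \<rightarrow> carrier M. \<forall>w\<in>lists I - {[]}. h w = word_prod M \<phi> w"
  then obtain \<phi> where "\<phi> \<in> I \<rightarrow> carrier M" "\<forall>w\<in>lists I - {[]}. h w = word_prod M \<phi> w"
    by blast
  then show "h \<in> hom (free_semigroup I) M"
    using word_prod_append_semigroup[OF assms, of \<phi> I] word_prod_closed_semigroup[OF assms, of \<phi> I]
    by (simp add: hom_def free_semigroup_def free_monoid_def del: in_lists_conv_set)
qed

lemma monoid_homs_free_monoid_iff_word_prod:
  assumes "monoid M"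
  shows "h \<in> monoid_homs (free_monoid I) M \<longleftrightarrow>
    (\<exists>\<phi>\<in>I \<rightarrow> carrier M. \<forall>w\<in>lists I. h w = word_prod M \<phi> w)"
proof
  assume "h \<in> monoid_homs (free_monoid I) M"
  then have h: "h \<in> hom (free_semigroup I) M" "h [] = \<one>\<^bsub>M\<^esub>"
    unfolding monoid_homs_def hom_def free_semigroup_def free_monoid_def Pi_def
    by simp_all
  obtain \<phi> where "\<phi> \<in> I \<rightarrow> carrier M" "\<forall>w\<in>lists I - {[]}. h w = word_prod M \<phi> w"
    using iffD1[OF hom_free_semigroup_iff_word_prod[OF is_semigroup_if_monoid[OF assms]] h(1)] ..
  moreover from this h(2) have "\<forall>w\<in>lists I. h w = word_prod M \<phi> w"
    by (auto simp: Ball_def)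
  ultimately show "\<exists>\<phi>\<in>I \<rightarrow> carrier M. \<forall>w\<in>lists I. h w = word_prod M \<phi> w"
    by blast
next
  assume "\<exists>\<phi>\<in>I \<rightarrow> carrier M. \<forall>w\<in>lists I. h w = word_prod M \<phi> w"
  then obtain \<phi> where "\<phi> \<in> I \<rightarrow> carrier M" "\<forall>w\<in>lists I. h w = word_prod M \<phi> w"
    by blast
  then show "h \<in> monoid_homs (free_monoid I) M"
    using word_prod_append_monoid[OF assms, of \<phi> I] word_prod_closed_monoid[OF assms, of \<phi> I]
    by (simp add: monoid_homs_def hom_def free_monoid_def del: in_lists_conv_set)
qed

text \<open>The alphabet \<open>I\<close> is arbitrary, so that the same notion covers both the identities over
  \<^typ>\<open>nat\<close> that define varieties and pairs of words over the generators of a free object.\<close>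
definition is_law :: "('a, 'b) monoid_scheme \<Rightarrow> 'x set \<Rightarrow> 'x list \<Rightarrow> 'x list \<Rightarrow> bool" where
  "is_law M I u v \<longleftrightarrow> (\<forall>\<phi>\<in>I \<rightarrow> carrier M. word_prod M \<phi> u = word_prod M \<phi> v)"

lemma monoid_variety_iff_is_law:
  "monoid_variety E M \<longleftrightarrow> monoid M \<and> (\<forall>(u, v)\<in>E. is_law M UNIV u v)"
proof (cases "monoid M")
  case True
  have "(\<forall>h\<in>monoid_homs (free_monoid UNIV) M. h u = h v) \<longleftrightarrow> is_law M UNIV u v"
    for u v :: "nat list"
  proof
    assume "\<forall>h\<in>monoid_homs (free_monoid UNIV) M. h u = h v"
    moreover have "word_prod M \<phi> \<in> monoid_homs (free_monoid UNIV) M"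
      if "\<phi> \<in> UNIV \<rightarrow> carrier M" for \<phi> :: "nat \<Rightarrow> _"
      using that by (auto simp only: monoid_homs_free_monoid_iff_word_prod[OF True])
    ultimately show "is_law M UNIV u v"
      by (auto simp only: is_law_def)
  qed (auto simp: is_law_def monoid_homs_free_monoid_iff_word_prod[OF True])
  then show ?thesis
    by (simp add: monoid_variety_def)
qed (simp add: monoid_variety_def)

lemma semigroup_variety_iff_is_law:
  assumes "E \<subseteq> carrier (free_semigroup UNIV) \<times> carrier (free_semigroup UNIV)"
  shows "semigroup_variety E M \<longleftrightarrow> is_semigroup M \<and> (\<forall>(u, v)\<in>E. is_law M UNIV u v)"
proof (cases "is_semigroup M")
  case True
  have "(\<forall>h\<in>hom (free_semigroup UNIV) M. h u = h v) \<longleftrightarrow> is_law M UNIV u v"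
    if "u \<noteq> []" "v \<noteq> []" for u v :: "nat list"
  proof
    assume "\<forall>h\<in>hom (free_semigroup UNIV) M. h u = h v"
    moreover have "word_prod M \<phi> \<in> hom (free_semigroup UNIV) M"
      if "\<phi> \<in> UNIV \<rightarrow> carrier M" for \<phi> :: "nat \<Rightarrow> _"
      using that by (auto simp only: hom_free_semigroup_iff_word_prod[OF True])
    ultimately show "is_law M UNIV u v"
      by (auto simp only: is_law_def)
  qed (use that in \<open>auto simp: is_law_def hom_free_semigroup_iff_word_prod[OF True]\<close>)
  moreover have "u \<noteq> [] \<and> v \<noteq> []" if "(u, v) \<in> E" for u v
    using assms that by (auto simp: free_semigroup_def)
  ultimately have "(\<forall>(u, v)\<in>E. \<forall>h\<in>hom (free_semigroup UNIV) M. h u = h v) \<longleftrightarrow>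
      (\<forall>(u, v)\<in>E. is_law M UNIV u v)"
    by (intro ball_cong) auto
  then show ?thesis
    using True by (simp only: semigroup_variety_def)
qed (simp add: semigroup_variety_def)

text \<open>The set of all laws of \<open>U\<close> is the strongest set of identities that \<open>U\<close> satisfies, so it is the
  only one that has to be tested.\<close>
lemma in_generated_monoid_variety_iff_is_law:
  fixes U :: "('u, 'v) monoid_scheme" and M :: "('a, 'b) monoid_scheme"
  assumes "monoid U"
  shows "in_generated_monoid_variety U M \<longleftrightarrow>
    monoid M \<and> (\<forall>u v :: nat list. is_law U UNIV u v \<longrightarrow> is_law M UNIV u v)"
proof
  assume M: "in_generated_monoid_variety U M"
  let ?E = "{(u :: nat list, v). is_law U UNIV u v}"
  have "monoid_variety ?E U"
    using assms by (simp add: monoid_variety_iff_is_law)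
  then have "monoid_variety ?E M"
    by (rule M[unfolded in_generated_monoid_variety_def, rule_format])
  then show "monoid M \<and> (\<forall>u v :: nat list. is_law U UNIV u v \<longrightarrow> is_law M UNIV u v)"
    by (simp add: monoid_variety_iff_is_law)
next
  assume "monoid M \<and> (\<forall>u v :: nat list. is_law U UNIV u v \<longrightarrow> is_law M UNIV u v)"
  then show "in_generated_monoid_variety U M"
    unfolding in_generated_monoid_variety_def monoid_variety_iff_is_law by fast
qed

lemma in_generated_semigroup_variety_iff_is_law:
  fixes U :: "('u, 'v) monoid_scheme" and M :: "('a, 'b) monoid_scheme"
  assumes "is_semigroup U"
  shows "in_generated_semigroup_variety U M \<longleftrightarrow>
    is_semigroup M \<and> (\<forall>u v :: nat list. u \<noteq> [] \<and> v \<noteq> [] \<and> is_law U UNIV u v \<longrightarrow> is_law M UNIV u v)"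
    (is "_ \<longleftrightarrow> ?R")
proof
  assume M: "in_generated_semigroup_variety U M"
  let ?E = "{(u :: nat list, v). u \<noteq> [] \<and> v \<noteq> [] \<and> is_law U UNIV u v}"
  have E: "?E \<subseteq> carrier (free_semigroup UNIV) \<times> carrier (free_semigroup UNIV)"
    by (auto simp: free_semigroup_def free_monoid_def)
  have "semigroup_variety ?E U"
    using assms by (simp add: semigroup_variety_iff_is_law[OF E])
  then have "semigroup_variety ?E M"
    by (rule M[unfolded in_generated_semigroup_variety_def, rule_format, OF E])
  then show ?R
    by (simp add: semigroup_variety_iff_is_law[OF E])
next
  assume R: ?R
  show "in_generated_semigroup_variety U M"
    unfolding in_generated_semigroup_variety_def
  proof (intro allI impI)
    fix E :: "(nat list \<times> nat list) set"
    assume E: "E \<subseteq> carrier (free_semigroup UNIV) \<times> carrier (free_semigroup UNIV)"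
      and U: "semigroup_variety E U"
    have "u \<noteq> []" "v \<noteq> []" if "(u, v) \<in> E" for u v
      using E that by (auto simp: free_semigroup_def)
    then show "semigroup_variety E M"
      using R U unfolding semigroup_variety_iff_is_law[OF E] by fast
  qed
qed


text \<open>Two words have finitely many letters between them, so an injective renaming of these letters by
  numbers turns a law over any alphabet into an identity of the kind that defines varieties.\<close>
lemma is_law_alphabet_transfer:
  fixes U :: "('u, 'v) monoid_scheme" and M :: "('a, 'b) monoid_scheme"
  assumes law: "is_law U I u v" and uv: "u \<in> lists I" "v \<in> lists I"
    and nat_laws: "\<And>\<iota> :: 'x \<Rightarrow> nat.
      is_law U UNIV (map \<iota> u) (map \<iota> v) \<Longrightarrow> is_law M UNIV (map \<iota> u) (map \<iota> v)"
  shows "is_law M I u v"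
  unfolding is_law_def
proof
  fix \<phi> assume \<phi>: "\<phi> \<in> I \<rightarrow> carrier M"
  obtain \<iota> :: "'x \<Rightarrow> nat" where \<iota>: "inj_on \<iota> (set u \<union> set v)"
    using finite_imp_inj_to_nat_seg[of "set u \<union> set v"] by auto
  have "is_law U UNIV (map \<iota> u) (map \<iota> v)"
    using law by (fastforce simp: is_law_def word_prod_map)
  then have M: "is_law M UNIV (map \<iota> u) (map \<iota> v)"
    by (rule nat_laws)
  show "word_prod M \<phi> u = word_prod M \<phi> v"
  proof (cases "set u \<union> set v = {}")
    case False
    (* Numbers that rename no letter still need a value in M; M may have no identity, so the value
       of some letter that occurs is used. *)
    then obtain c where c: "c \<in> set u \<union> set v"
      by (meson ex_in_conv)
    define \<chi> where "\<chi> = (\<lambda>k. \<phi> (if k \<in> \<iota> ` (set u \<union> set v) then inv_into (set u \<union> set v) \<iota> k else c))"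
    have sub: "set u \<union> set v \<subseteq> I"
      using uv by (auto simp: in_lists_conv_set)
    have "\<chi> k \<in> carrier M" for k
      using inv_into_into[of k \<iota> "set u \<union> set v"] c sub \<phi> unfolding \<chi>_def by (auto split: if_splits)
    then have "word_prod M (\<chi> \<circ> \<iota>) u = word_prod M (\<chi> \<circ> \<iota>) v"
      using M by (auto simp: is_law_def word_prod_map)
    moreover have "(\<chi> \<circ> \<iota>) x = \<phi> x" if "x \<in> set u \<union> set v" for x
      using that inv_into_f_f[OF \<iota> that] by (auto simp: \<chi>_def)
    ultimately show ?thesis
      by (metis UnCI word_prod_cong)
  qed simp
qed

text \<open>Every element of \<open>F\<close> is the class of a word. Evaluating a law of \<open>U\<close> in \<open>F\<close> therefore amounts
  to substituting words for its letters, which yields another law of \<open>U\<close>, now over \<open>I\<close>, and the two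
  sides of that one are identified in \<open>F\<close>. The premise \<open>one\<close> lets \<open>W\<close> be all words, or all nonempty
  words with both sides of the law nonempty.\<close>
lemma laws_hold_in_quotient_of_words:
  fixes r :: "'x list \<Rightarrow> 'f" and u v :: "'y list"
  assumes "monoid U" and W: "W \<subseteq> lists I"
    and mult: "\<And>u v. u \<in> W \<Longrightarrow> v \<in> W \<Longrightarrow> u @ v \<in> W \<and> r u \<otimes>\<^bsub>F\<^esub> r v = r (u @ v)"
    and one: "[] \<in> W \<and> r [] = \<one>\<^bsub>F\<^esub> \<or> u \<noteq> [] \<and> v \<noteq> []"
    and carrier: "carrier F = r ` W"
    and kernel: "\<And>u v. u \<in> W \<Longrightarrow> v \<in> W \<Longrightarrow> is_law U I u v \<Longrightarrow> r u = r v"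
    and law: "is_law U UNIV u v"
  shows "is_law F UNIV u v"
  unfolding is_law_def
proof
  fix \<phi> :: "'y \<Rightarrow> 'f" assume "\<phi> \<in> UNIV \<rightarrow> carrier F"
  then have "\<forall>x. \<exists>w\<in>W. \<phi> x = r w"
    using carrier by blast
  then obtain s :: "'y \<Rightarrow> 'x list" where s: "\<And>x. s x \<in> W" "\<And>x. \<phi> x = r (s x)"
    by metis
  have eval: "concat (map s w) \<in> W \<and> word_prod F \<phi> w = r (concat (map s w))"
    if "[] \<in> W \<and> r [] = \<one>\<^bsub>F\<^esub> \<or> w \<noteq> []" for w
    using that
  proof (induction w)
    case (Cons x w)
    show ?case
    proof (cases "w = []")
      case False
      then show ?thesis
        using Cons mult[of "s x" "concat (map s w)"] s by (simp add: word_prod_Cons)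
    qed (simp add: s)
  qed simp
  have W': "concat (map s u) \<in> W" "concat (map s v) \<in> W"
    using eval[of u] eval[of v] one by blast+
  have "is_law U I (concat (map s u)) (concat (map s v))"
    unfolding is_law_def
  proof
    fix \<psi> assume \<psi>: "\<psi> \<in> I \<rightarrow> carrier U"
    have "s x \<in> lists I" for x
      using s(1) W by blast
    then show "word_prod U \<psi> (concat (map s u)) = word_prod U \<psi> (concat (map s v))"
      using law word_prod_closed_monoid[OF assms(1) \<psi>]
      by (simp add: word_prod_concat_monoid[OF assms(1) \<psi>] is_law_def)
  qed
  then show "word_prod F \<phi> u = word_prod F \<phi> v"
    using eval[of u] eval[of v] kernel[OF W'] one by metis
qed

text \<open>A quotient of the free monoid by exactly the laws of \<open>U\<close> is free in the variety of \<open>U\<close>: it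
  satisfies all these laws, and since each member \<open>M\<close> of the variety satisfies them too, the
  value in \<open>M\<close> of a word depends only on the class of the word.\<close>
lemma freely_generates_monoid_if_kernel_is_laws:
  fixes U :: "('u, 'v) monoid_scheme" and F :: "('f, 'b) monoid_scheme"
  assumes "monoid U"
    and carrier: "carrier F = r ` lists I"
    and mult: "\<And>u v. u \<in> lists I \<Longrightarrow> v \<in> lists I \<Longrightarrow> r u \<otimes>\<^bsub>F\<^esub> r v = r (u @ v)"
    and one: "\<one>\<^bsub>F\<^esub> = r []"
    and kernel: "\<And>u v. u \<in> lists I \<Longrightarrow> v \<in> lists I \<Longrightarrow> r u = r v \<longleftrightarrow> is_law U I u v"
  shows "freely_generates_monoid TYPE('m) U F I (\<lambda>i. r [i])"
  unfolding freely_generates_monoid_def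
proof (intro conjI allI impI)
  have "monoid F"
    by (intro monoidI) (auto simp: carrier one mult)
  moreover have "is_law F UNIV u v" if "is_law U UNIV u v" for u v :: "nat list"
    using laws_hold_in_quotient_of_words[OF assms(1), of "lists I" I F r u v] that assms by auto
  ultimately show "in_generated_monoid_variety U F"
    by (simp add: in_generated_monoid_variety_iff_is_law[OF assms(1)])
  show "(\<lambda>i. r [i]) ` I \<subseteq> carrier F"
    by (auto simp: carrier)
next
  fix M :: "'m monoid" and \<phi>
  assume asm: "in_generated_monoid_variety U M \<and> \<phi> \<in> I \<rightarrow> carrier M"
  then have M: "monoid M" and \<phi>: "\<phi> \<in> I \<rightarrow> carrier M"
    and laws: "\<And>u v :: nat list. is_law U UNIV u v \<Longrightarrow> is_law M UNIV u v"
    by (auto simp: in_generated_monoid_variety_iff_is_law[OF assms(1)])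
  have wd: "word_prod M \<phi> u = word_prod M \<phi> v" if "u \<in> lists I" "v \<in> lists I" "r u = r v" for u v
    proof -
    have "is_law U I u v"
      using that kernel by blast
    then have "is_law M I u v"
      using that laws by (intro is_law_alphabet_transfer[of U I u v M]) auto
    then show ?thesis
      using \<phi> by (simp add: is_law_def)
  qed
  define h where "h = restrict (\<lambda>x. word_prod M \<phi> (SOME w. w \<in> lists I \<and> r w = x)) (carrier F)"
  have h: "h (r w) = word_prod M \<phi> w" if "w \<in> lists I" for w
  proof -
    define v where "v = (SOME v. v \<in> lists I \<and> r v = r w)"
    have "v \<in> lists I" "r v = r w"
      using someI[of "\<lambda>v. v \<in> lists I \<and> r v = r w" w] that by (simp_all add: v_def)
    then have "word_prod M \<phi> v = word_prod M \<phi> w"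
      using that by (intro wd)
    moreover have "r w \<in> carrier F"
      using that by (simp add: carrier)
    ultimately show ?thesis
      by (simp add: h_def v_def)
  qed
  show "\<exists>!h. h \<in> extensional (carrier F) \<and> h \<in> monoid_homs F M \<and> (\<forall>i\<in>I. h (r [i]) = \<phi> i)"
  proof (rule ex1I[of _ h])
    show "h \<in> extensional (carrier F) \<and> h \<in> monoid_homs F M \<and> (\<forall>i\<in>I. h (r [i]) = \<phi> i)"
      using h word_prod_closed_monoid[OF M \<phi>] word_prod_append_monoid[OF M \<phi>]
      by (auto simp: monoid_homs_def hom_def carrier mult one) (simp add: h_def carrier)
  next
    fix k assume k: "k \<in> extensional (carrier F) \<and> k \<in> monoid_homs F M \<and> (\<forall>i\<in>I. k (r [i]) = \<phi> i)"
    then have kr: "(\<lambda>w. k (r w)) \<in> monoid_homs (free_monoid I) M"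
      using mult by (force simp: monoid_homs_def hom_def free_monoid_def carrier one[symmetric])
    obtain \<psi> where \<psi>: "\<forall>w\<in>lists I. k (r w) = word_prod M \<psi> w"
      using iffD1[OF monoid_homs_free_monoid_iff_word_prod[OF M] kr] by auto
    then have "\<psi> i = \<phi> i" if "i \<in> I" for i
      using k that by force
    then have "word_prod M \<psi> w = word_prod M \<phi> w" if "w \<in> lists I" for w
      using that by (intro word_prod_cong) (auto simp: in_lists_conv_set)
    then have "k (r w) = h (r w)" if "w \<in> lists I" for w
      using \<psi> h that by simp
    then show "k = h"
      using k by (intro extensionalityI[of k "carrier F"]) (auto simp: h_def carrier)
  qed
qed

lemma freely_generates_semigroup_if_kernel_is_laws:
  fixes U :: "('u, 'v) monoid_scheme" and F :: "('f, 'b) monoid_scheme"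
  assumes "monoid U"
    and carrier: "carrier F = r ` (lists I - {[]})"
    and mult: "\<And>u v. u \<in> lists I - {[]} \<Longrightarrow> v \<in> lists I - {[]} \<Longrightarrow> r u \<otimes>\<^bsub>F\<^esub> r v = r (u @ v)"
    and kernel: "\<And>u v. u \<in> lists I - {[]} \<Longrightarrow> v \<in> lists I - {[]} \<Longrightarrow> r u = r v \<longleftrightarrow> is_law U I u v"
  shows "freely_generates_semigroup TYPE('m) U F I (\<lambda>i. r [i])"
  unfolding freely_generates_semigroup_def
proof (intro conjI allI impI)
  note U = is_semigroup_if_monoid[OF assms(1)]
  have "is_semigroup F"
    by (auto simp: is_semigroup_def carrier mult)
  moreover have "is_law F UNIV u v" if "u \<noteq> []" "v \<noteq> []" "is_law U UNIV u v" for u v :: "nat list"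
    using laws_hold_in_quotient_of_words[OF assms(1), of "lists I - {[]}" I F r u v] that assms by auto
  ultimately show "in_generated_semigroup_variety U F"
    by (simp add: in_generated_semigroup_variety_iff_is_law[OF U])
  show "(\<lambda>i. r [i]) ` I \<subseteq> carrier F"
    by (auto simp: carrier)
next
  note U = is_semigroup_if_monoid[OF assms(1)]
  fix M :: "'m monoid" and \<phi>
  assume asm: "in_generated_semigroup_variety U M \<and> \<phi> \<in> I \<rightarrow> carrier M"
  then have M: "is_semigroup M" and \<phi>: "\<phi> \<in> I \<rightarrow> carrier M"
    and laws: "\<And>u v :: nat list. u \<noteq> [] \<Longrightarrow> v \<noteq> [] \<Longrightarrow> is_law U UNIV u v \<Longrightarrow> is_law M UNIV u v"
    by (auto simp: in_generated_semigroup_variety_iff_is_law[OF U])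
  have wd: "word_prod M \<phi> u = word_prod M \<phi> v"
    if "u \<in> lists I - {[]}" "v \<in> lists I - {[]}" "r u = r v" for u v
    proof -
    have "is_law U I u v"
      using that kernel by blast
    then have "is_law M I u v"
      using that laws by (intro is_law_alphabet_transfer[of U I u v M]) auto
    then show ?thesis
      using \<phi> by (simp add: is_law_def)
  qed
  define h where
    "h = restrict (\<lambda>x. word_prod M \<phi> (SOME w. w \<in> lists I - {[]} \<and> r w = x)) (carrier F)"
  have h: "h (r w) = word_prod M \<phi> w" if "w \<in> lists I - {[]}" for w
  proof -
    define v where "v = (SOME v. v \<in> lists I - {[]} \<and> r v = r w)"
    have "v \<in> lists I - {[]}" "r v = r w"
      using someI[of "\<lambda>v. v \<in> lists I - {[]} \<and> r v = r w" w] that by (simp_all add: v_def)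
    then have "word_prod M \<phi> v = word_prod M \<phi> w"
      using that by (intro wd)
    moreover have "r w \<in> carrier F"
      using that by (simp add: carrier)
    ultimately show ?thesis
      by (simp add: h_def v_def)
  qed
  show "\<exists>!h. h \<in> extensional (carrier F) \<and> h \<in> hom F M \<and> (\<forall>i\<in>I. h (r [i]) = \<phi> i)"
  proof (rule ex1I[of _ h])
    show "h \<in> extensional (carrier F) \<and> h \<in> hom F M \<and> (\<forall>i\<in>I. h (r [i]) = \<phi> i)"
    proof (intro conjI ballI)
      show "h \<in> hom F M"
      proof (rule homI)
        fix x assume "x \<in> carrier F"
        then obtain u where u: "u \<in> lists I - {[]}" "x = r u"
          unfolding carrier by blast
        then show "h x \<in> carrier M"
          using word_prod_closed_semigroup[OF M \<phi>, of u] by (simp add: h)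
        fix y assume "y \<in> carrier F"
        then obtain v where "v \<in> lists I - {[]}" "y = r v"
          unfolding carrier by blast
        with u show "h (x \<otimes>\<^bsub>F\<^esub> y) = h x \<otimes>\<^bsub>M\<^esub> h y"
          using word_prod_append_semigroup[OF M \<phi>, of u v] by (simp add: h mult)
      qed
    qed (simp add: h_def, simp add: h)
  next
    fix k assume k: "k \<in> extensional (carrier F) \<and> k \<in> hom F M \<and> (\<forall>i\<in>I. k (r [i]) = \<phi> i)"
    then have kF: "k \<in> hom F M"
      by blast
    have kr: "(\<lambda>w. k (r w)) \<in> hom (free_semigroup I) M"
      using hom_in_carrier[OF kF] hom_mult[OF kF]
      by (intro homI) (simp_all add: free_semigroup_def free_monoid_def carrier mult[symmetric])
    obtain \<psi> where \<psi>: "\<forall>w\<in>lists I - {[]}. k (r w) = word_prod M \<psi> w"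
      using iffD1[OF hom_free_semigroup_iff_word_prod[OF M] kr] by auto
    then have "\<psi> i = \<phi> i" if "i \<in> I" for i
      using k that by force
    then have "word_prod M \<psi> w = word_prod M \<phi> w" if "w \<in> lists I - {[]}" for w
      using that by (intro word_prod_cong) (auto simp: in_lists_conv_set)
    then have "k (r w) = h (r w)" if "w \<in> lists I - {[]}" for w
      using \<psi> h that by simp
    then show "k = h"
      using k by (intro extensionalityI[of k "carrier F"]) (auto simp: h_def carrier)
  qed
qed

section \<open>Polynomial functions form a commutative semiring\<close>

definition monom_eval :: "('x \<Rightarrow>\<^sub>0 nat) \<Rightarrow> ('x \<Rightarrow> 'a :: comm_semiring_1) \<Rightarrow> 'a" where
  "monom_eval m a = (\<Prod>x\<in>Poly_Mapping.keys m. a x ^ Poly_Mapping.lookup m x)"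

lemma monom_eval_superset:
  assumes "finite X" "Poly_Mapping.keys m \<subseteq> X"
  shows "monom_eval m a = (\<Prod>x\<in>X. a x ^ Poly_Mapping.lookup m x)"
  unfolding monom_eval_def using assms
  by (intro prod.mono_neutral_left) (auto simp: in_keys_iff)

lemma monom_eval_add: "monom_eval (m + m') a = monom_eval m a * monom_eval m' a"
proof -
  let ?X = "Poly_Mapping.keys m \<union> Poly_Mapping.keys m'"
  have "monom_eval (m + m') a = (\<Prod>x\<in>?X. a x ^ Poly_Mapping.lookup (m + m') x)"
    by (intro monom_eval_superset) (auto simp: Poly_Mapping.keys_add)
  also have "\<dots> = monom_eval m a * monom_eval m' a"
    by (simp add: lookup_add power_add prod.distrib monom_eval_superset[of ?X])
  finally show ?thesis .
qed

lemma poly_eval_superset: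
  assumes "finite X" "Poly_Mapping.keys p \<subseteq> X"
  shows "poly_eval p a = (\<Sum>m\<in>X. Poly_Mapping.lookup p m * monom_eval m a)"
  unfolding poly_eval_def monom_eval_def[symmetric] using assms
  by (intro sum.mono_neutral_left) (auto simp: in_keys_iff)

lemma poly_eval_zero: "poly_eval 0 a = 0"
  by (simp add: poly_eval_def)

lemma poly_eval_add: "poly_eval (p + q) a = poly_eval p a + poly_eval q a"
proof -
  let ?X = "Poly_Mapping.keys p \<union> Poly_Mapping.keys q"
  have "poly_eval (p + q) a = (\<Sum>m\<in>?X. Poly_Mapping.lookup (p + q) m * monom_eval m a)"
    by (intro poly_eval_superset) (auto simp: Poly_Mapping.keys_add)
  also have "\<dots> = poly_eval p a + poly_eval q a"
    by (simp add: lookup_add distrib_right sum.distrib poly_eval_superset[of ?X])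
  finally show ?thesis .
qed

lemma poly_eval_sum: "poly_eval (\<Sum>i\<in>A. f i) a = (\<Sum>i\<in>A. poly_eval (f i) a)"
  by (induction A rule: infinite_finite_induct) (simp_all add: poly_eval_zero poly_eval_add)

lemma poly_eval_single: "poly_eval (Poly_Mapping.single m c) a = c * monom_eval m a"
  by (subst poly_eval_superset[of "{m}"]) auto

lemma poly_mapping_eq_sum_single:
  "p = (\<Sum>m\<in>Poly_Mapping.keys p. Poly_Mapping.single m (Poly_Mapping.lookup p m))"
  by (rule poly_mapping_eqI) (auto simp: lookup_sum lookup_single when_def in_keys_iff)

text \<open>Both sides are biadditive, so it is enough to compare them on products of single terms, where
  the claim is that evaluation of monomials turns sums of exponents into products.\<close>
lemma poly_eval_mult: "poly_eval (p * q) a = poly_eval p a * poly_eval q a"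
proof -
  let ?K = "Poly_Mapping.keys" and ?L = "Poly_Mapping.lookup"
  have "p * q = (\<Sum>m\<in>?K p. Poly_Mapping.single m (?L p m)) * (\<Sum>k\<in>?K q. Poly_Mapping.single k (?L q k))"
    using poly_mapping_eq_sum_single[of p] poly_mapping_eq_sum_single[of q] by simp
  also have "\<dots> = (\<Sum>m\<in>?K p. \<Sum>k\<in>?K q. Poly_Mapping.single (m + k) (?L p m * ?L q k))"
    by (simp add: sum_product mult_single)
  finally have "poly_eval (p * q) a =
      (\<Sum>m\<in>?K p. \<Sum>k\<in>?K q. (?L p m * monom_eval m a) * (?L q k * monom_eval k a))"
    by (simp add: poly_eval_sum poly_eval_single monom_eval_add mult_ac)
  also have "\<dots> = poly_eval p a * poly_eval q a"
    by (simp add: poly_eval_def monom_eval_def sum_product)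
  finally show ?thesis .
qed

context
  fixes A :: "'a :: comm_semiring_1 itself" and X :: "'x set"
begin

lemma polyfunI:
  assumes "p \<in> polynomials X" "\<And>a. f a = poly_eval p a"
  shows "f \<in> carrier (polyfun_semiring A X)"
  using assms by (auto simp: polyfun_semiring_def image_iff fun_eq_iff)

lemma polyfunE:
  assumes "f \<in> carrier (polyfun_semiring A X)"
  obtains p where "p \<in> polynomials X" "f = poly_eval p"
  using assms by (auto simp: polyfun_semiring_def)

lemma polyfun_zero: "(\<lambda>_. 0) \<in> carrier (polyfun_semiring A X)"
  by (rule polyfunI[of 0]) (simp_all add: polynomials_def poly_eval_zero)

lemma polyfun_one: "(\<lambda>_. 1) \<in> carrier (polyfun_semiring A X)"
  by (rule polyfunI[of "Poly_Mapping.single 0 1"])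
    (simp_all add: polynomials_def poly_eval_single monom_eval_def del: single_one)

lemma polyfun_var: "x \<in> X \<Longrightarrow> (\<lambda>a. a x) \<in> carrier (polyfun_semiring A X)"
  by (rule polyfunI[of "Poly_Mapping.single (Poly_Mapping.single x 1) 1"])
    (simp_all add: polynomials_def poly_eval_single monom_eval_def)

lemma polyfun_add:
  assumes "f \<in> carrier (polyfun_semiring A X)" "g \<in> carrier (polyfun_semiring A X)"
  shows "(\<lambda>a. f a + g a) \<in> carrier (polyfun_semiring A X)"
proof -
  obtain p where p: "p \<in> polynomials X" "f = poly_eval p"
    using assms(1) by (rule polyfunE)
  obtain q where q: "q \<in> polynomials X" "g = poly_eval q"
    using assms(2) by (rule polyfunE)
  have "p + q \<in> polynomials X"
    using p q Poly_Mapping.keys_add[of p q] by (fastforce simp: polynomials_def)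
  then show ?thesis
    by (rule polyfunI) (simp add: poly_eval_add p q)
qed

lemma polyfun_mult:
  assumes "f \<in> carrier (polyfun_semiring A X)" "g \<in> carrier (polyfun_semiring A X)"
  shows "(\<lambda>a. f a * g a) \<in> carrier (polyfun_semiring A X)"
proof -
  obtain p where p: "p \<in> polynomials X" "f = poly_eval p"
    using assms(1) by (rule polyfunE)
  obtain q where q: "q \<in> polynomials X" "g = poly_eval q"
    using assms(2) by (rule polyfunE)
  have "Poly_Mapping.keys m \<subseteq> X" if m: "m \<in> Poly_Mapping.keys (p * q)" for m
  proof -
    obtain b c where bc: "m = b + c" "b \<in> Poly_Mapping.keys p" "c \<in> Poly_Mapping.keys q"
      using m keys_mult[of p q] by blast
    then have "Poly_Mapping.keys b \<subseteq> X" "Poly_Mapping.keys c \<subseteq> X"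
      using p q by (simp_all add: polynomials_def)
    then show ?thesis
      using Poly_Mapping.keys_add[of b c] unfolding bc by blast
  qed
  then have "p * q \<in> polynomials X"
    by (simp add: polynomials_def)
  then show ?thesis
    by (rule polyfunI) (simp add: poly_eval_mult p q)
qed

lemmas polyfun_closed = polyfun_zero polyfun_one polyfun_var polyfun_add polyfun_mult

lemma polyfun_simps:
  "mult (polyfun_semiring A X) = (\<lambda>f g a. f a * g a)"
  "one (polyfun_semiring A X) = (\<lambda>a. 1)"
  "zero (polyfun_semiring A X) = (\<lambda>a. 0)"
  "add (polyfun_semiring A X) = (\<lambda>f g a. f a + g a)"
  by (simp_all add: polyfun_semiring_def)

lemma polyfun_comm_monoid: "comm_monoid (polyfun_semiring A X)"
  by (rule comm_monoidI) (simp_all add: polyfun_simps polyfun_closed mult_ac)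

lemma polyfun_abelian_monoid: "abelian_monoid (polyfun_semiring A X)"
  by (rule abelian_monoidI) (simp_all add: polyfun_simps polyfun_closed add_ac)

text \<open>The finite sums and products of the semiring are taken within its carrier; on families in the
  carrier they agree with the pointwise ones, in which all later computations are done.\<close>
lemma polyfun_finsum:
  assumes "f \<in> I \<rightarrow> carrier (polyfun_semiring A X)"
  shows "finsum (polyfun_semiring A X) f I = (\<lambda>a. \<Sum>i\<in>I. f i a)"
  using assms
proof (induction I rule: infinite_finite_induct)
  case (insert i I)
  then have "finsum (polyfun_semiring A X) f (insert i I) =
      f i \<oplus>\<^bsub>polyfun_semiring A X\<^esub> finsum (polyfun_semiring A X) f I"
    by (intro abelian_monoid.finsum_insert[OF polyfun_abelian_monoid]) auto
  with insert show ?case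
    by (simp add: polyfun_simps)
qed (simp_all add: abelian_monoid.finsum_infinite abelian_monoid.finsum_empty
  polyfun_abelian_monoid polyfun_simps)

lemma polyfun_finprod:
  assumes "f \<in> I \<rightarrow> carrier (polyfun_semiring A X)"
  shows "finprod (polyfun_semiring A X) f I = (\<lambda>a. \<Prod>i\<in>I. f i a)"
  using assms
proof (induction I rule: infinite_finite_induct)
  case (insert i I)
  then have "finprod (polyfun_semiring A X) f (insert i I) =
      f i \<otimes>\<^bsub>polyfun_semiring A X\<^esub> finprod (polyfun_semiring A X) f I"
    by (intro comm_monoid.finprod_insert[OF polyfun_comm_monoid]) auto
  with insert show ?case
    by (simp add: polyfun_simps)
qed (simp_all add: comm_monoid.finprod_infinite comm_monoid.finprod_empty
  polyfun_comm_monoid polyfun_simps)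

end

section \<open>Ambles and the multiplicativity of \<open>\<rho>\<close>\<close>

text \<open>If \<open>es\<close> is a path from \<open>i\<close> without loops, this is the value at \<open>a\<close> of its coefficient in \<open>\<rho>(w)\<close>,
  computed by looking at the first arc of an amble: a loop at \<open>i\<close>, or the first arc of \<open>es\<close>.\<close>
fun amble_sum :: "'s list \<Rightarrow> nat \<Rightarrow> 's arc list \<Rightarrow> ('s \<times> nat \<Rightarrow> 'a :: comm_semiring_1) \<Rightarrow> 'a" where
  "amble_sum [] i es a = (if es = [] then 1 else 0)"
| "amble_sum (\<sigma> # w) i es a = a (\<sigma>, i) * amble_sum w i es a +
    (case es of [] \<Rightarrow> 0
     | e # es' \<Rightarrow> if arc_label e = \<sigma> then amble_sum w (snd (snd e)) es' a else 0)"

lemma wf_Gamma0: "wf_digraph (Gamma0 n \<Sigma>)"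
  by unfold_locales (auto simp: Gamma0_def)

lemma wf_Gamma: "wf_digraph (Gamma n \<Sigma>)"
  by unfold_locales (auto simp: Gamma_def Gamma0_def)

lemma paths_Nil_iff: "(u, []) \<in> paths G \<longleftrightarrow> u \<in> verts G"
  by (auto simp: paths_def pre_digraph.awalk_def pre_digraph.cas.simps)

lemma paths_Cons_iff:
  assumes "wf_digraph G"
  shows "(u, e # p) \<in> paths G \<longleftrightarrow> e \<in> arcs G \<and> tail G e = u \<and> (head G e, p) \<in> paths G"
  by (auto simp: paths_def wf_digraph.awalk_Cons_iff[OF assms])

lemma path_end_Nil: "path_end G (u, []) = u"
  by (simp add: path_end_def pre_digraph.awalk_verts.simps)

lemma path_end_Cons: "path_end G (u, e # p) = path_end G (head G e, p)"
  by (cases p) (simp_all add: path_end_def pre_digraph.awalk_verts.simps)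

lemma paths_append_iff:
  assumes "wf_digraph G"
  shows "(u, p @ q) \<in> paths G \<longleftrightarrow> (u, p) \<in> paths G \<and> (path_end G (u, p), q) \<in> paths G"
  by (induction p arbitrary: u)
    (auto simp: paths_Cons_iff[OF assms] path_end_Nil path_end_Cons paths_Nil_iff,
     auto simp: paths_def pre_digraph.awalk_def)

text \<open>A factorization of a path is determined by the length of its first factor.\<close>
lemma factorizations_eq:
  assumes "wf_digraph G" "(u, p) \<in> paths G"
  shows "factorizations G (u, p) =
    (\<lambda>k. ((u, take k p), (path_end G (u, take k p), drop k p))) ` {..length p}" (is "_ = ?R")
proof
  show "factorizations G (u, p) \<subseteq> ?R"
  proof
    fix st assume "st \<in> factorizations G (u, p)"
    then obtain s t where "st = ((u, s), (path_end G (u, s), t))" "p = s @ t"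
      by (auto simp: factorizations_def)
    then show "st \<in> ?R"
      by (intro image_eqI[of _ _ "length s"]) auto
  qed
  have "(u, take k p) \<in> paths G \<and> (path_end G (u, take k p), drop k p) \<in> paths G" for k
    using paths_append_iff[OF assms(1), of u "take k p" "drop k p"] assms(2) by simp
  then show "?R \<subseteq> factorizations G (u, p)"
    by (auto simp: factorizations_def)
qed

lemma factorizations_empty:
  assumes "wf_digraph G" "x \<notin> paths G"
  shows "factorizations G x = {}"
  using assms(2) paths_append_iff[OF assms(1)] by (auto simp: factorizations_def)

lemma Gamma_simps:
  "verts (Gamma n \<Sigma>) = {1..n}" "tail (Gamma n \<Sigma>) = fst" "head (Gamma n \<Sigma>) e = snd (snd e)"
  "(i, \<sigma>, j) \<in> arcs (Gamma n \<Sigma>) \<longleftrightarrow> 1 \<le> i \<and> i < j \<and> j \<le> n \<and> \<sigma> \<in> \<Sigma>"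
  by (auto simp: Gamma_def Gamma0_def is_loop_def)

lemma Gamma0_simps:
  "verts (Gamma0 n \<Sigma>) = {1..n}" "tail (Gamma0 n \<Sigma>) = fst" "head (Gamma0 n \<Sigma>) e = snd (snd e)"
  "(i, \<sigma>, j) \<in> arcs (Gamma0 n \<Sigma>) \<longleftrightarrow> 1 \<le> i \<and> i \<le> j \<and> j \<le> n \<and> \<sigma> \<in> \<Sigma>"
  by (auto simp: Gamma0_def)

text \<open>The ambles of the path that starts at \<open>i\<close> and has arcs \<open>es\<close>, without their start vertex, which is
  again \<open>i\<close>. As plain lists of arcs they are amenable to recursion on the word.\<close>
definition amble_arcs :: "nat \<Rightarrow> 's set \<Rightarrow> nat \<Rightarrow> 's arc list \<Rightarrow> 's list \<Rightarrow> 's arc list set" where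
  "amble_arcs n \<Sigma> i es w =
    {p. (i, p) \<in> paths (Gamma0 n \<Sigma>) \<and> map arc_label p = w \<and> filter (\<lambda>e. \<not> is_loop e) p = es}"

lemma ambles_eq: "ambles n \<Sigma> (i, es) w = Pair i ` amble_arcs n \<Sigma> i es w"
  by (auto simp: ambles_def amble_arcs_def path_label_def remove_loops_def)

lemma amble_arcs_Nil:
  "i \<in> {1..n} \<Longrightarrow> amble_arcs n \<Sigma> i es [] = (if es = [] then {[]} else {})"
  by (auto simp: amble_arcs_def paths_Nil_iff Gamma0_simps)

text \<open>The first arc of an amble is removed with the loops, and then it is a loop at \<open>i\<close>, or it survives
  and is the first arc of \<open>es\<close>. Since a path of \<^const>\<open>Gamma\<close> has no loops, no amble falls under
  both cases.\<close>
lemma amble_arcs_Cons: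
  assumes "(i, es) \<in> paths (Gamma n \<Sigma>)" "\<sigma> \<in> \<Sigma>"
  shows "amble_arcs n \<Sigma> i es (\<sigma> # w) = Cons (i, \<sigma>, i) ` amble_arcs n \<Sigma> i es w \<union>
    (case es of [] \<Rightarrow> {}
     | e # es' \<Rightarrow> if arc_label e = \<sigma> then Cons e ` amble_arcs n \<Sigma> (snd (snd e)) es' w else {})"
    (is "_ = ?L \<union> ?N")
proof
  have i: "i \<in> {1..n}"
    using assms(1) by (auto simp: paths_def pre_digraph.awalk_def Gamma_simps)
  show "amble_arcs n \<Sigma> i es (\<sigma> # w) \<subseteq> ?L \<union> ?N"
  proof
    fix p assume p: "p \<in> amble_arcs n \<Sigma> i es (\<sigma> # w)"
    then obtain j q where "p = (i, \<sigma>, j) # q" "(j, q) \<in> paths (Gamma0 n \<Sigma>)" "map arc_label q = w"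
      by (auto simp: amble_arcs_def paths_Cons_iff[OF wf_Gamma0] arc_label_def Gamma0_simps)
    with p show "p \<in> ?L \<union> ?N"
      by (cases "i = j") (auto simp: amble_arcs_def is_loop_def arc_label_def)
  qed
  show "?L \<union> ?N \<subseteq> amble_arcs n \<Sigma> i es (\<sigma> # w)"
  proof (cases es)
    case Nil
    then show ?thesis
      using i assms(2)
      by (auto simp: amble_arcs_def paths_Cons_iff[OF wf_Gamma0] is_loop_def arc_label_def Gamma0_simps)
  next
    case (Cons e es')
    moreover obtain j \<tau> where "e = (i, \<tau>, j)" "i < j" "j \<le> n" "\<tau> \<in> \<Sigma>"
      using assms(1) Cons
      by (cases e) (auto simp: paths_Cons_iff[OF wf_Gamma] Gamma_simps)
    ultimately show ?thesis
      using i assms(2)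
      by (auto simp: amble_arcs_def paths_Cons_iff[OF wf_Gamma0] is_loop_def arc_label_def Gamma0_simps)
  qed
qed

text \<open>Finiteness is proved along with the value, as splitting the sum requires it.\<close>
lemma sum_amble_arcs:
  assumes "(i, es) \<in> paths (Gamma n \<Sigma>)" "w \<in> lists \<Sigma>"
  shows "finite (amble_arcs n \<Sigma> i es w) \<and>
    (\<Sum>p\<in>amble_arcs n \<Sigma> i es w. \<Prod>e\<leftarrow>p. arc_factor e a) = amble_sum w i es a"
  using assms(2,1)
proof (induction w arbitrary: i es)
  case Nil
  then have "i \<in> {1..n}"
    by (auto simp: paths_def pre_digraph.awalk_def Gamma_simps)
  then show ?case
    by (simp add: amble_arcs_Nil)
next
  case (Cons \<sigma> w)
  note IH = Cons.IH[OF Cons.prems]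
  have loop: "(\<Sum>p\<in>Cons (i, \<sigma>, i) ` amble_arcs n \<Sigma> i es w. \<Prod>e\<leftarrow>p. arc_factor e a) =
      a (\<sigma>, i) * amble_sum w i es a"
    using IH by (simp add: sum.reindex sum_distrib_left[symmetric] arc_factor_def is_loop_def arc_label_def)
  show ?case
  proof (cases "\<exists>e es'. es = e # es' \<and> arc_label e = \<sigma>")
    case False
    then have "amble_arcs n \<Sigma> i es (\<sigma> # w) = Cons (i, \<sigma>, i) ` amble_arcs n \<Sigma> i es w"
      using amble_arcs_Cons[OF Cons.prems Cons.hyps(1), of w] by (cases es) auto
    then show ?thesis
      using False loop IH by (cases es) auto
  next
    case True
    then obtain e es' where es: "es = e # es'" "arc_label e = \<sigma>"
      by blast
    then have e: "\<not> is_loop e" "(snd (snd e), es') \<in> paths (Gamma n \<Sigma>)"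
      using Cons.prems
      by (cases e; auto simp: paths_Cons_iff[OF wf_Gamma] Gamma_simps is_loop_def)+
    note IH' = Cons.IH[OF e(2)]
    have eq: "amble_arcs n \<Sigma> i es (\<sigma> # w) =
        Cons (i, \<sigma>, i) ` amble_arcs n \<Sigma> i es w \<union> Cons e ` amble_arcs n \<Sigma> (snd (snd e)) es' w"
      using amble_arcs_Cons[OF Cons.prems Cons.hyps(1), of w] es by simp
    have step: "(\<Sum>p\<in>Cons e ` amble_arcs n \<Sigma> (snd (snd e)) es' w. \<Prod>e\<leftarrow>p. arc_factor e a) =
        amble_sum w (snd (snd e)) es' a"
      using IH' e by (simp add: sum.reindex arc_factor_def)
    have "Cons (i, \<sigma>, i) ` amble_arcs n \<Sigma> i es w \<inter> Cons e ` amble_arcs n \<Sigma> (snd (snd e)) es' w = {}"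
      using e by (auto simp: is_loop_def)
    then show ?thesis
      unfolding eq using IH IH' loop step es by (simp add: sum.union_disjoint)
  qed
qed

lemma arc_factor_closed:
  assumes "e \<in> arcs (Gamma0 n \<Sigma>)"
  shows "arc_factor e \<in> carrier (coeff_semiring TYPE('a :: comm_semiring_1) n \<Sigma>)"
  using assms
  by (cases e) (auto simp: arc_factor_def arc_label_def variables_def Gamma0_simps polyfun_one
    intro!: polyfun_var)

lemma path_coeff_eq_amble_sum:
  assumes "(i, es) \<in> paths (Gamma n \<Sigma>)" "w \<in> lists \<Sigma>"
  shows "path_coeff TYPE('a :: comm_semiring_1) n \<Sigma> w (i, es) = amble_sum w i es"
proof
  fix a :: "_ \<Rightarrow> 'a"
  let ?R = "coeff_semiring TYPE('a) n \<Sigma>"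
  have factors: "arc_factor (snd \<tau> ! k) \<in> carrier ?R"
    if "\<tau> \<in> ambles n \<Sigma> (i, es) w" "k < length (snd \<tau>)" for \<tau> k
  proof -
    have "set (snd \<tau>) \<subseteq> arcs (Gamma0 n \<Sigma>)"
      using that(1) by (auto simp: ambles_def paths_def pre_digraph.awalk_def)
    then show ?thesis
      using that(2) by (intro arc_factor_closed) auto
  qed
  then have mono: "amble_monomial TYPE('a) n \<Sigma> \<tau> = (\<lambda>a. \<Prod>e\<leftarrow>snd \<tau>. arc_factor e a)"
    if "\<tau> \<in> ambles n \<Sigma> (i, es) w" for \<tau>
    using that unfolding amble_monomial_def
    by (subst polyfun_finprod) (auto simp: prod.list_conv_set_nth atLeast0LessThan)
  have "amble_monomial TYPE('a) n \<Sigma> \<in> ambles n \<Sigma> (i, es) w \<rightarrow> carrier ?R"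
    unfolding amble_monomial_def using factors
    by (auto intro!: comm_monoid.finprod_closed[OF polyfun_comm_monoid])
  then have "path_coeff TYPE('a) n \<Sigma> w (i, es) a =
      (\<Sum>\<tau>\<in>ambles n \<Sigma> (i, es) w. amble_monomial TYPE('a) n \<Sigma> \<tau> a)"
    unfolding path_coeff_def by (simp add: polyfun_finsum)
  also have "\<dots> = (\<Sum>\<tau>\<in>ambles n \<Sigma> (i, es) w. \<Prod>e\<leftarrow>snd \<tau>. arc_factor e a)"
    by (simp add: mono)
  also have "\<dots> = (\<Sum>p\<in>amble_arcs n \<Sigma> i es w. \<Prod>e\<leftarrow>p. arc_factor e a)"
    by (simp add: ambles_eq sum.reindex inj_on_def)
  also have "\<dots> = amble_sum w i es a"
    using sum_amble_arcs[OF assms] by blast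
  finally show "path_coeff TYPE('a) n \<Sigma> w (i, es) a = amble_sum w i es a" .
qed

lemma rho_apply:
  assumes "w \<in> lists \<Sigma>"
  shows "rho TYPE('a :: comm_semiring_1) n \<Sigma> w (i, es) =
    (if (i, es) \<in> paths (Gamma n \<Sigma>) then amble_sum w i es else (\<lambda>_. 0))"
  using path_coeff_eq_amble_sum[where 'a = 'a, OF _ assms] by (simp add: rho_def polyfun_simps)

lemma amble_sum_closed:
  assumes "(i, es) \<in> paths (Gamma n \<Sigma>)" "w \<in> lists \<Sigma>"
  shows "amble_sum w i es \<in> carrier (coeff_semiring TYPE('a :: comm_semiring_1) n \<Sigma>)"
  using assms(2,1)
proof (induction w arbitrary: i es)
  case Nil
  then show ?case
    by (simp add: polyfun_closed)
next
  case (Cons \<sigma> w)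
  have "i \<in> {1..n}"
    using Cons.prems by (auto simp: paths_def pre_digraph.awalk_def Gamma_simps)
  then have v: "(\<sigma>, i) \<in> variables n \<Sigma>"
    using Cons.hyps by (simp add: variables_def)
  have "(\<lambda>a. case es of [] \<Rightarrow> 0 | e # es' \<Rightarrow> if arc_label e = \<sigma> then amble_sum w (snd (snd e)) es' a else 0)
      \<in> carrier (coeff_semiring TYPE('a) n \<Sigma>)"
    using Cons.prems Cons.IH
    by (cases es; cases "arc_label (hd es) = \<sigma>") (auto simp: polyfun_zero paths_Cons_iff[OF wf_Gamma] Gamma_simps)
  then show ?case
    using Cons.IH[OF Cons.prems] v by (simp add: polyfun_closed)
qed

text \<open>An amble for \<open>w\<close> can only traverse as many arcs as \<open>w\<close> has letters, with labels among these
  letters. Hence \<open>\<rho>(w)\<close> has finite support even when \<open>\<Sigma>\<close> is infinite.\<close>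
lemma amble_sum_support:
  "amble_sum w i es a \<noteq> 0 \<Longrightarrow> length es \<le> length w \<and> arc_label ` set es \<subseteq> set w"
proof (induction w arbitrary: i es)
  case (Cons \<sigma> w)
  then have "amble_sum w i es a \<noteq> 0 \<or>
      (\<exists>e es'. es = e # es' \<and> arc_label e = \<sigma> \<and> amble_sum w (snd (snd e)) es' a \<noteq> 0)"
    by (cases es) (auto split: if_splits)
  then show ?case
    using Cons.IH by fastforce
qed (simp split: if_splits)

text \<open>An amble labelled \<open>u @ v\<close> splits uniquely into its parts labelled \<open>u\<close> and \<open>v\<close>, and the non-loop
  arcs of the first part form a prefix of \<open>es\<close>, here the one of length \<open>k\<close>.\<close>
lemma amble_sum_append:
  "amble_sum (u @ v) i es a = (\<Sum>k\<le>length es.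
    amble_sum u i (take k es) a * amble_sum v (path_end (Gamma n \<Sigma>) (i, take k es)) (drop k es) a)"
proof (induction u arbitrary: i es)
  case Nil
  have "(\<Sum>k\<le>length es. amble_sum [] i (take k es) a *
        amble_sum v (path_end (Gamma n \<Sigma>) (i, take k es)) (drop k es) a) =
      (\<Sum>k\<in>{0}. amble_sum [] i (take k es) a *
        amble_sum v (path_end (Gamma n \<Sigma>) (i, take k es)) (drop k es) a)"
    by (intro sum.mono_neutral_right) auto
  then show ?case
    by (simp add: path_end_Nil)
next
  case (Cons \<sigma> u)
  show ?case
  proof (cases es)
    case Nil
    then show ?thesis
      using Cons.IH[of i "[]"] by (simp add: path_end_Nil mult.assoc)
  next
    case (Cons e r)
    let ?E = "path_end (Gamma n \<Sigma>)"
    (* In the second sum below, k = 0 contributes nothing: the first arc of es is then not in the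
       part belonging to u. Dropping that term shifts the index to match the induction hypothesis. *)
    have "amble_sum ((\<sigma> # u) @ v) i es a = a (\<sigma>, i) * amble_sum (u @ v) i es a +
        (if arc_label e = \<sigma> then amble_sum (u @ v) (snd (snd e)) r a else 0)"
      by (simp add: Cons)
    also have "\<dots> = (\<Sum>k\<le>length es.
          a (\<sigma>, i) * (amble_sum u i (take k es) a * amble_sum v (?E (i, take k es)) (drop k es) a)) +
        (\<Sum>k\<le>length es. (case take k es of [] \<Rightarrow> 0
            | e # es' \<Rightarrow> if arc_label e = \<sigma> then amble_sum u (snd (snd e)) es' a else 0) *
          amble_sum v (?E (i, take k es)) (drop k es) a)"
      unfolding Cons.IH
      by (simp add: Cons sum.atMost_Suc_shift sum_distrib_left distrib_left path_end_Cons Gamma_simps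
        del: sum.atMost_Suc)
    finally show ?thesis
      by (simp add: sum.distrib[symmetric] distrib_right mult.assoc)
  qed
qed

text \<open>The coefficients are polynomial functions by \<open>amble_sum_closed\<close>; the point is finite support.\<close>
lemma rho_closed:
  assumes "w \<in> lists \<Sigma>"
  shows "rho TYPE('a :: comm_semiring_1) n \<Sigma> w \<in> carrier (rho_algebra TYPE('a) n \<Sigma>)"
proof -
  let ?S = "{1..n} \<times> {es. set es \<subseteq> {1..n} \<times> set w \<times> {1..n} \<and> length es \<le> length w}"
  have "{x. rho TYPE('a) n \<Sigma> w x \<noteq> (\<lambda>_. 0)} \<subseteq> ?S"
  proof
    fix x assume x: "x \<in> {x. rho TYPE('a) n \<Sigma> w x \<noteq> (\<lambda>_. 0)}"
    obtain i es where ies: "x = (i, es)"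
      by (cases x)
    with x have path: "(i, es) \<in> paths (Gamma n \<Sigma>)" and "amble_sum w i es \<noteq> (\<lambda>_. 0 :: 'a)"
      by (auto simp: rho_apply[OF assms] split: if_splits)
    then obtain a :: "_ \<Rightarrow> 'a" where "amble_sum w i es a \<noteq> 0"
      by auto
    from amble_sum_support[OF this] have "length es \<le> length w" "arc_label ` set es \<subseteq> set w"
      by auto
    moreover have "i \<in> {1..n}" "set es \<subseteq> arcs (Gamma n \<Sigma>)"
      using path by (auto simp: paths_def pre_digraph.awalk_def Gamma_simps)
    ultimately show "x \<in> ?S"
      unfolding ies by (force simp: arc_label_def Gamma_simps)
  qed
  moreover have "finite ?S"
    by (intro finite_cartesian_product finite_lists_length_le) auto
  ultimately have "finite {x. rho TYPE('a) n \<Sigma> w x \<noteq> (\<lambda>_. 0)}"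
    by (rule finite_subset)
  moreover have "rho TYPE('a) n \<Sigma> w x \<in> carrier (coeff_semiring TYPE('a) n \<Sigma>)"
    if "x \<in> paths (Gamma n \<Sigma>)" for x
    using that by (cases x) (simp add: rho_apply[OF assms] amble_sum_closed[OF _ assms])
  moreover have "rho TYPE('a) n \<Sigma> w x = (\<lambda>_. 0)" if "x \<notin> paths (Gamma n \<Sigma>)" for x
    using that by (cases x) (simp add: rho_apply[OF assms])
  ultimately show ?thesis
    by (simp add: quiver_algebra_def polyfun_simps)
qed

lemma rho_Nil: "rho TYPE('a :: comm_semiring_1) n \<Sigma> [] = \<one>\<^bsub>rho_algebra TYPE('a) n \<Sigma>\<^esub>"
  by (auto simp: fun_eq_iff rho_apply quiver_algebra_def polyfun_simps paths_Nil_iff)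

lemma rho_append:
  fixes \<Sigma> :: "'s set"
  assumes "u \<in> lists \<Sigma>" "v \<in> lists \<Sigma>"
  shows "rho TYPE('a :: comm_semiring_1) n \<Sigma> u \<otimes>\<^bsub>rho_algebra TYPE('a) n \<Sigma>\<^esub> rho TYPE('a) n \<Sigma> v =
    rho TYPE('a) n \<Sigma> (u @ v)"
proof (intro ext)
  fix x :: "(nat, 's arc) path" and a :: "'s \<times> nat \<Rightarrow> 'a"
  let ?R = "coeff_semiring TYPE('a) n \<Sigma>"
  let ?f = "\<lambda>st. rho TYPE('a) n \<Sigma> u (fst st) \<otimes>\<^bsub>?R\<^esub> rho TYPE('a) n \<Sigma> v (snd st)"
  obtain i es where x: "x = (i, es)"
    by (cases x)
  have uv: "u @ v \<in> lists \<Sigma>"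
    using assms by simp
  have "?f st \<in> carrier ?R" if "st \<in> factorizations (Gamma n \<Sigma>) x" for st
    using that assms unfolding polyfun_simps
    by (intro polyfun_mult) (auto simp: factorizations_def rho_apply amble_sum_closed)
  then have "(rho TYPE('a) n \<Sigma> u \<otimes>\<^bsub>rho_algebra TYPE('a) n \<Sigma>\<^esub> rho TYPE('a) n \<Sigma> v) x a =
      (\<Sum>st\<in>factorizations (Gamma n \<Sigma>) x. ?f st a)"
    by (simp add: quiver_algebra_def polyfun_finsum)
  also have "\<dots> = rho TYPE('a) n \<Sigma> (u @ v) x a"
  proof (cases "x \<in> paths (Gamma n \<Sigma>)")
    case False
    then show ?thesis
      by (simp add: x factorizations_empty[OF wf_Gamma] rho_apply[OF uv])
  next
    case True
    have inj: "inj_on (\<lambda>k. ((i, take k es), path_end (Gamma n \<Sigma>) (i, take k es), drop k es)) {..length es}"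
    proof (rule inj_onI)
      fix k l assume "k \<in> {..length es}" "l \<in> {..length es}"
        "((i, take k es), path_end (Gamma n \<Sigma>) (i, take k es), drop k es) =
         ((i, take l es), path_end (Gamma n \<Sigma>) (i, take l es), drop l es)"
      then have "length (take k es) = length (take l es)" "k \<le> length es" "l \<le> length es"
        by auto
      then show "k = l"
        by simp
    qed
    have "(i, take k es) \<in> paths (Gamma n \<Sigma>)"
      "(path_end (Gamma n \<Sigma>) (i, take k es), drop k es) \<in> paths (Gamma n \<Sigma>)" for k
      using paths_append_iff[OF wf_Gamma, of i "take k es" "drop k es"] True x by auto
    then show ?thesis
      using True unfolding x factorizations_eq[OF wf_Gamma True[unfolded x]] sum.reindex[OF inj]
      by (simp add: rho_apply assms uv polyfun_simps amble_sum_append[of u v i es a n \<Sigma>])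
  qed
  finally show "(rho TYPE('a) n \<Sigma> u \<otimes>\<^bsub>rho_algebra TYPE('a) n \<Sigma>\<^esub> rho TYPE('a) n \<Sigma> v) x a =
    rho TYPE('a) n \<Sigma> (u @ v) x a" .
qed

section \<open>Upper triangular matrices and the kernel of \<open>\<rho>\<close>\<close>

lemma UT_simps:
  "A \<in> carrier (UT TYPE('a :: comm_semiring_1) n) \<longleftrightarrow> A \<in> carrier_mat n n \<and> upper_triangular A"
  "mult (UT TYPE('a) n) = (*)" "one (UT TYPE('a) n) = 1\<^sub>m n"
  by (auto simp: UT_def)

text \<open>Vertices of the quivers are numbered from 1 and matrix indices from 0. All entries are
  therefore addressed as \<open>(i - 1, j - 1)\<close> with \<open>i\<close> and \<open>j\<close> vertices.\<close>
lemma UT_mult_index: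
  assumes "A \<in> carrier_mat n n" "B \<in> carrier_mat n n" "i \<in> {1..n}" "j \<in> {1..n}"
  shows "(A * B) $$ (i - 1, j - 1) = (\<Sum>k\<in>{1..n}. A $$ (i - 1, k - 1) * B $$ (k - 1, j - 1))"
proof -
  have "(A * B) $$ (i - 1, j - 1) = (\<Sum>k\<in>{0..<n}. A $$ (i - 1, k) * B $$ (k, j - 1))"
    using assms by (auto simp: scalar_prod_def)
  also have "\<dots> = (\<Sum>k\<in>{1..n}. A $$ (i - 1, k - 1) * B $$ (k - 1, j - 1))"
    by (rule sum.reindex_bij_witness[of _ "\<lambda>k. k - 1" Suc]) auto
  finally show ?thesis .
qed

lemma upper_triangular_mult:
  assumes "A \<in> carrier_mat n n" "B \<in> carrier_mat n n" "upper_triangular A" "upper_triangular B"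
  shows "upper_triangular (A * B :: 'a :: comm_semiring_1 mat)"
proof (rule upper_triangularI)
  fix i j assume ij: "j < i" "i < dim_row (A * B)"
  have "A $$ (i, k) * B $$ (k, j) = 0" if "k < n" for k
    using that ij assms upper_triangularD[of A k i] upper_triangularD[of B j k]
    by (cases "k < i") auto
  then show "(A * B) $$ (i, j) = 0"
    using ij assms by (auto simp: scalar_prod_def intro!: sum.neutral)
qed

lemma monoid_UT: "monoid (UT TYPE('a :: comm_semiring_1) n)"
  by (rule monoidI) (auto simp: UT_simps upper_triangular_mult intro: assoc_mult_mat)

text \<open>Paths from \<open>i\<close> to \<open>j\<close> without loops, as plain lists of arcs; both ends are kept because the
  \<open>(i, j)\<close> entry of a matrix product is a sum over them.\<close>
definition walks :: "nat \<Rightarrow> 's set \<Rightarrow> nat \<Rightarrow> nat \<Rightarrow> 's arc list set" where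
  "walks n \<Sigma> i j = {es. pre_digraph.awalk (Gamma n \<Sigma>) i es j}"

lemma walks_Nil_iff: "[] \<in> walks n \<Sigma> i j \<longleftrightarrow> i = j \<and> i \<in> {1..n}"
  by (auto simp: walks_def wf_digraph.awalk_Nil_iff[OF wf_Gamma] Gamma_simps)

lemma walks_Cons_iff:
  "(k, \<sigma>, l) # es \<in> walks n \<Sigma> i j \<longleftrightarrow>
    i = k \<and> 1 \<le> k \<and> k < l \<and> l \<le> n \<and> \<sigma> \<in> \<Sigma> \<and> es \<in> walks n \<Sigma> l j"
  by (auto simp: walks_def wf_digraph.awalk_Cons_iff[OF wf_Gamma] Gamma_simps)

lemma paths_Gamma_iff_walks: "(i, es) \<in> paths (Gamma n \<Sigma>) \<longleftrightarrow> (\<exists>j. es \<in> walks n \<Sigma> i j)"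
  by (simp add: paths_def walks_def)

lemma walks_arcs:
  assumes "es \<in> walks n \<Sigma> i j" "(k, \<sigma>, l) \<in> set es"
  shows "i \<le> k \<and> 1 \<le> k \<and> k < l \<and> l \<le> n \<and> \<sigma> \<in> \<Sigma>"
  using assms by (induction es arbitrary: i) (fastforce simp: walks_Cons_iff)+

lemma walks_ends: "es \<in> walks n \<Sigma> i j \<Longrightarrow> 1 \<le> i \<and> i + length es \<le> j \<and> j \<le> n"
  by (induction es arbitrary: i) (fastforce simp: walks_Nil_iff walks_Cons_iff)+

text \<open>Used to restrict to the finitely many letters that matter for two given words, so that the sums
  over \<^const>\<open>walks\<close> become finite.\<close>
lemma walks_alphabet:
  assumes "es \<in> walks n \<Sigma> i j" "arc_label ` set es \<subseteq> \<Delta>"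
  shows "es \<in> walks n \<Delta> i j"
  using assms by (induction es arbitrary: i) (auto simp: walks_Nil_iff walks_Cons_iff arc_label_def)

lemma walks_mono: "\<Delta> \<subseteq> \<Sigma> \<Longrightarrow> walks n \<Delta> i j \<subseteq> walks n \<Sigma> i j"
  by (rule subsetI, rule walks_alphabet, assumption) (fastforce simp: arc_label_def dest: walks_arcs)

lemma finite_walks:
  assumes "finite \<Sigma>"
  shows "finite (walks n \<Sigma> i j)"
proof (rule finite_subset)
  show "walks n \<Sigma> i j \<subseteq> {es. set es \<subseteq> {1..n} \<times> \<Sigma> \<times> {1..n} \<and> length es \<le> n}"
  proof
    fix es assume es: "es \<in> walks n \<Sigma> i j"
    have "set es \<subseteq> {1..n} \<times> \<Sigma> \<times> {1..n}"
      using walks_arcs[OF es] by fastforce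
    then show "es \<in> {es. set es \<subseteq> {1..n} \<times> \<Sigma> \<times> {1..n} \<and> length es \<le> n}"
      using walks_ends[OF es] by simp
  qed
qed (use assms in \<open>intro finite_lists_length_le finite_cartesian_product; simp\<close>)

text \<open>Vertices strictly increase along a walk, so among the arcs of \<open>es\<close> only the first one leaves the
  start vertex. A walk made of arcs of \<open>es\<close> must begin with it, and so on; it cannot stop early,
  since it has to reach \<open>j\<close>.\<close>
lemma walks_eq_if_subset:
  assumes "es \<in> walks n \<Sigma> i j" "ds \<in> walks n \<Sigma> i j" "set ds \<subseteq> set es"
  shows "ds = es"
  using assms
proof (induction es arbitrary: i ds)
  case (Cons e es)
  obtain \<sigma> k where e: "e = (i, \<sigma>, k)" "i < k" "es \<in> walks n \<Sigma> k j"
    using Cons.prems(1) by (cases e) (auto simp: walks_Cons_iff)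
  then have "i < j"
    using walks_ends[OF e(3)] by simp
  then obtain d ds' where d: "ds = d # ds'"
    using Cons.prems(2) by (cases ds) (auto simp: walks_Nil_iff)
  have later: "e \<notin> set ls \<and> fst ` set ls \<subseteq> {i<..}" if "ls \<in> walks n \<Sigma> k j" for ls
    using walks_arcs[OF that] e by fastforce
  have "fst d = i"
    using Cons.prems(2) d by (cases d) (auto simp: walks_Cons_iff)
  then have "d = e"
    using Cons.prems(3) d later[OF e(3)] by auto
  then have ds': "ds' \<in> walks n \<Sigma> k j"
    using Cons.prems(2) d e by (simp add: walks_Cons_iff)
  then have "set ds' \<subseteq> set es"
    using Cons.prems(3) d later[OF ds'] by auto
  then show ?case
    using Cons.IH[OF e(3) ds'] d \<open>d = e\<close> by simp
qed simp

abbreviation arc_entry :: "('s \<Rightarrow> 'a mat) \<Rightarrow> 's arc \<Rightarrow> 'a" where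
  "arc_entry \<psi> e \<equiv> \<psi> (arc_label e) $$ (fst e - 1, snd (snd e) - 1)"

abbreviation diagonal :: "('s \<Rightarrow> 'a mat) \<Rightarrow> 's \<times> nat \<Rightarrow> 'a" where
  "diagonal \<psi> \<equiv> (\<lambda>(\<sigma>, v). \<psi> \<sigma> $$ (v - 1, v - 1))"

text \<open>The expansion of a matrix product as a sum over paths, with the paths grouped by what remains
  once the loops are removed: the loops account for diagonal entries and are collected in
  \<^const>\<open>amble_sum\<close>. The induction step splits the row of the first matrix into the diagonal entry
  (first edge a loop) and the entries to its right (first edge belongs to the walk); those to its
  left vanish.\<close>
lemma word_prod_UT_entry:
  fixes \<psi> :: "'s \<Rightarrow> 'a :: comm_semiring_1 mat"
  assumes "finite \<Sigma>" and \<psi>: "\<psi> \<in> \<Sigma> \<rightarrow> carrier (UT TYPE('a) n)" and "w \<in> lists \<Sigma>"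
    and "i \<in> {1..n}" and j: "j \<in> {1..n}"
  shows "word_prod (UT TYPE('a) n) \<psi> w $$ (i - 1, j - 1) =
    (\<Sum>es\<in>walks n \<Sigma> i j. (\<Prod>e\<leftarrow>es. arc_entry \<psi> e) * amble_sum w i es (diagonal \<psi>))"
  using assms(3,4)
proof (induction w arbitrary: i)
  case Nil
  have "(\<Sum>es\<in>walks n \<Sigma> i j. (\<Prod>e\<leftarrow>es. arc_entry \<psi> e) * amble_sum [] i es (diagonal \<psi>)) =
      (\<Sum>es\<in>walks n \<Sigma> i j. if es = [] then 1 else 0)"
    by (intro sum.cong) auto
  also have "\<dots> = (if [] \<in> walks n \<Sigma> i j then 1 else 0)"
    by (simp add: finite_walks assms(1))
  also have "\<dots> = (1\<^sub>m n :: 'a mat) $$ (i - 1, j - 1)"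
    using Nil j by (auto simp: walks_Nil_iff)
  finally show ?case
    by (simp add: UT_simps)
next
  case (Cons \<sigma> w)
  let ?W = "\<lambda>es. \<Prod>e\<leftarrow>es. arc_entry \<psi> e"
  let ?P = "word_prod (UT TYPE('a) n) \<psi> w"
  (* The contribution of the walk es to the paths whose first edge is not a loop. *)
  let ?g = "\<lambda>es. ?W es * (case es of [] \<Rightarrow> 0
    | e # es' \<Rightarrow> if arc_label e = \<sigma> then amble_sum w (snd (snd e)) es' (diagonal \<psi>) else 0)"
  have \<sigma>: "\<psi> \<sigma> \<in> carrier_mat n n" "upper_triangular (\<psi> \<sigma>)"
    using \<psi> Cons.hyps(1) by (auto simp: UT_simps)
  have P: "?P \<in> carrier_mat n n"
    using word_prod_closed_monoid[OF monoid_UT \<psi> Cons.hyps(2)] by (simp add: UT_simps)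
  have "\<psi> \<sigma> $$ (i - 1, k - 1) = 0" if "k \<in> {1..<i}" for k
    using that Cons.prems \<sigma> by (intro upper_triangularD) auto
  then have below: "(\<Sum>k\<in>{1..<i}. \<psi> \<sigma> $$ (i - 1, k - 1) * ?P $$ (k - 1, j - 1)) = 0"
    by (intro sum.neutral) simp
  have "{1..n} = {1..<i} \<union> insert i {i<..n}"
    using Cons.prems by auto
  then have "(\<psi> \<sigma> * ?P) $$ (i - 1, j - 1) =
      (\<Sum>k\<in>{1..<i} \<union> insert i {i<..n}. \<psi> \<sigma> $$ (i - 1, k - 1) * ?P $$ (k - 1, j - 1))"
    using UT_mult_index[OF \<sigma>(1) P Cons.prems j] by simp
  also have "\<dots> = \<psi> \<sigma> $$ (i - 1, i - 1) * ?P $$ (i - 1, j - 1) +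
      (\<Sum>k\<in>{i<..n}. \<psi> \<sigma> $$ (i - 1, k - 1) * ?P $$ (k - 1, j - 1))"
    using below by (subst sum.union_disjoint) auto
  also have "(\<Sum>k\<in>{i<..n}. \<psi> \<sigma> $$ (i - 1, k - 1) * ?P $$ (k - 1, j - 1)) =
      (\<Sum>k\<in>{i<..n}. \<Sum>es\<in>walks n \<Sigma> k j. ?g ((i, \<sigma>, k) # es))"
    using Cons.IH by (intro sum.cong) (auto simp: sum_distrib_left arc_label_def mult.assoc)
  also have "\<dots> = (\<Sum>(k, es)\<in>(SIGMA k:{i<..n}. walks n \<Sigma> k j). ?g ((i, \<sigma>, k) # es))"
    by (simp add: sum.Sigma finite_walks assms(1))
  also have "\<dots> = (\<Sum>es\<in>(\<lambda>(k, es). (i, \<sigma>, k) # es) ` (SIGMA k:{i<..n}. walks n \<Sigma> k j). ?g es)"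
    by (subst sum.reindex) (auto simp: inj_on_def case_prod_unfold)
  also have "\<dots> = (\<Sum>es\<in>walks n \<Sigma> i j. ?g es)"
  proof (rule sum.mono_neutral_left)
    show "(\<lambda>(k, es). (i, \<sigma>, k) # es) ` (SIGMA k:{i<..n}. walks n \<Sigma> k j) \<subseteq> walks n \<Sigma> i j"
      using Cons.prems Cons.hyps(1) by (auto simp: walks_Cons_iff)
    show "\<forall>es\<in>walks n \<Sigma> i j - (\<lambda>(k, es). (i, \<sigma>, k) # es) ` (SIGMA k:{i<..n}. walks n \<Sigma> k j). ?g es = 0"
    proof
      fix es assume es: "es \<in> walks n \<Sigma> i j - (\<lambda>(k, es). (i, \<sigma>, k) # es) ` (SIGMA k:{i<..n}. walks n \<Sigma> k j)"
      show "?g es = 0"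
      proof (cases es)
        case (Cons e es')
        then show ?thesis
          using es by (cases e) (force simp: walks_Cons_iff arc_label_def)
      qed simp
    qed
  qed (simp add: finite_walks assms(1))
  also have "\<psi> \<sigma> $$ (i - 1, i - 1) * ?P $$ (i - 1, j - 1) =
      (\<Sum>es\<in>walks n \<Sigma> i j. ?W es * (diagonal \<psi> (\<sigma>, i) * amble_sum w i es (diagonal \<psi>)))"
    unfolding Cons.IH[OF Cons.prems] by (simp add: sum_distrib_left mult_ac)
  finally have "(\<psi> \<sigma> * ?P) $$ (i - 1, j - 1) =
      (\<Sum>es\<in>walks n \<Sigma> i j. ?W es * amble_sum (\<sigma> # w) i es (diagonal \<psi>))"
    by (simp add: sum.distrib distrib_left del: One_nat_def)
  moreover have "word_prod (UT TYPE('a) n) \<psi> (\<sigma> # w) = \<psi> \<sigma> * ?P"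
    using \<psi> Cons.hyps(1) by (subst word_prod_Cons_monoid[OF monoid_UT]) (auto simp: UT_simps)
  ultimately show ?case
    by simp
qed

lemma amble_sum_cong:
  assumes "es \<in> walks n \<Sigma> i j" "\<And>\<sigma> v. v \<in> {1..n} \<Longrightarrow> a (\<sigma>, v) = b (\<sigma>, v)"
  shows "amble_sum w i es a = amble_sum w i es b"
  using assms(1)
proof (induction w arbitrary: i es)
  case (Cons \<sigma> w)
  have "i \<in> {1..n}"
    using walks_ends[OF Cons.prems] by auto
  then show ?case
    using Cons assms(2) by (cases es) (auto simp: walks_Cons_iff)
qed simp

lemma prod_list_eq_0: "0 \<in> set xs \<Longrightarrow> prod_list xs = (0 :: 'a :: comm_semiring_1)"
  by (induction xs) auto

text \<open>Each value of each coefficient of \<open>\<rho>(w)\<close> is an entry of a product of upper triangular matrices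
  along \<open>w\<close>, and the matrices depend only on the path and the assignment, not on \<open>w\<close>. With \<open>a\<close> on the
  diagonals and \<open>1\<close> exactly at the arcs of \<open>es\<close>, every other walk with the same ends gets weight \<open>0\<close>.\<close>
lemma amble_sum_eq_word_prod_UT_entry:
  fixes a :: "'s \<times> nat \<Rightarrow> 'a :: comm_semiring_1"
  assumes "es \<in> walks n \<Sigma> i j" "w \<in> lists \<Sigma>"
  defines "\<psi> \<equiv> \<lambda>\<sigma>. mat n n (\<lambda>(p, q). if p = q then a (\<sigma>, Suc p)
    else if (Suc p, \<sigma>, Suc q) \<in> set es then 1 else 0)"
  shows "\<psi> \<in> \<Sigma> \<rightarrow> carrier (UT TYPE('a) n) \<and>
    word_prod (UT TYPE('a) n) \<psi> w $$ (i - 1, j - 1) = amble_sum w i es a"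
proof
  note arcs = walks_arcs[OF assms(1)]
  show UT: "\<psi> \<in> \<Sigma> \<rightarrow> carrier (UT TYPE('a) n)"
    using arcs by (fastforce simp: UT_simps \<psi>_def)
  have ij: "i \<in> {1..n}" "j \<in> {1..n}"
    using walks_ends[OF assms(1)] by auto
  let ?D = "arc_label ` set es \<union> set w"
  have D: "?D \<subseteq> \<Sigma>"
    using arcs assms(2) by (fastforce simp: in_lists_conv_set arc_label_def)
  have es: "es \<in> walks n ?D i j"
    using assms(1) by (rule walks_alphabet) simp
  have weight: "(\<Prod>e\<leftarrow>ds. arc_entry \<psi> e) = (if ds = es then 1 else 0)" if ds: "ds \<in> walks n ?D i j" for ds
  proof -
    have entry: "arc_entry \<psi> e = (if e \<in> set es then 1 else 0)" if "e \<in> set ds" for e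
      using walks_arcs[OF ds, of "fst e" "fst (snd e)" "snd (snd e)"] that
      by (cases e) (auto simp: \<psi>_def arc_label_def)
    show ?thesis
    proof (cases "set ds \<subseteq> set es")
      case True
      then have "map (arc_entry \<psi>) ds = map (\<lambda>_. 1) ds"
        using entry by (intro map_cong) auto
      then show ?thesis
        using walks_eq_if_subset[OF es ds True] by (simp add: map_replicate_const)
    next
      case False
      then have "0 \<in> set (map (arc_entry \<psi>) ds)"
        using entry by force
      then have "(\<Prod>e\<leftarrow>ds. arc_entry \<psi> e) = 0"
        by (rule prod_list_eq_0)
      then show ?thesis
        using False by auto
    qed
  qed
  have "word_prod (UT TYPE('a) n) \<psi> w $$ (i - 1, j - 1) =
      (\<Sum>ds\<in>walks n ?D i j. (\<Prod>e\<leftarrow>ds. arc_entry \<psi> e) * amble_sum w i ds (diagonal \<psi>))"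
    using UT D ij by (intro word_prod_UT_entry) (auto simp: in_lists_conv_set)
  also have "\<dots> = (\<Sum>ds\<in>walks n ?D i j. if ds = es then amble_sum w i ds (diagonal \<psi>) else 0)"
    by (intro sum.cong) (simp_all add: weight del: One_nat_def)
  also have "\<dots> = amble_sum w i es (diagonal \<psi>)"
    using es by (simp add: finite_walks)
  also have "\<dots> = amble_sum w i es a"
    using assms(1) by (rule amble_sum_cong) (auto simp: \<psi>_def)
  finally show "word_prod (UT TYPE('a) n) \<psi> w $$ (i - 1, j - 1) = amble_sum w i es a" .
qed

lemma rho_eq_iff_amble_sum:
  assumes "u \<in> lists \<Sigma>" "v \<in> lists \<Sigma>"
  shows "rho TYPE('a :: comm_semiring_1) n \<Sigma> u = rho TYPE('a) n \<Sigma> v \<longleftrightarrow>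
    (\<forall>i j. \<forall>es\<in>walks n \<Sigma> i j. \<forall>a :: 's \<times> nat \<Rightarrow> 'a. amble_sum u i es a = amble_sum v i es a)"
  by (auto simp: fun_eq_iff[of "rho _ _ _ _"] rho_apply assms paths_Gamma_iff_walks) (auto simp: fun_eq_iff)

text \<open>The expansion of matrix entries shows that \<open>\<rho>\<close> identifies only the two sides of laws, and the
  realization of coefficients as matrix entries shows that it identifies all of these.\<close>
lemma rho_eq_iff_law_of_UT:
  assumes "u \<in> lists \<Sigma>" "v \<in> lists \<Sigma>"
  shows "rho TYPE('a :: comm_semiring_1) n \<Sigma> u = rho TYPE('a) n \<Sigma> v \<longleftrightarrow> is_law (UT TYPE('a) n) \<Sigma> u v"
proof
  assume eq: "rho TYPE('a) n \<Sigma> u = rho TYPE('a) n \<Sigma> v"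
  show "is_law (UT TYPE('a) n) \<Sigma> u v"
    unfolding is_law_def
  proof
    fix \<psi> assume \<psi>: "\<psi> \<in> \<Sigma> \<rightarrow> carrier (UT TYPE('a) n)"
    let ?D = "set u \<union> set v"
    have D: "?D \<subseteq> \<Sigma>" "finite ?D" "u \<in> lists ?D" "v \<in> lists ?D"
      using assms by (auto simp: in_lists_conv_set)
    have \<psi>': "\<psi> \<in> ?D \<rightarrow> carrier (UT TYPE('a) n)"
      using \<psi> D(1) by blast
    let ?M = "word_prod (UT TYPE('a) n) \<psi>"
    have "?M u \<in> carrier_mat n n" "?M v \<in> carrier_mat n n"
      using word_prod_closed_monoid[OF monoid_UT \<psi>] assms by (simp_all add: UT_simps)
    moreover have "?M u $$ (p, q) = ?M v $$ (p, q)" if "p < n" "q < n" for p q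
    proof -
      have pq: "Suc p \<in> {1..n}" "Suc q \<in> {1..n}"
        using that by auto
      have "amble_sum u (Suc p) es a = amble_sum v (Suc p) es a" if "es \<in> walks n ?D (Suc p) (Suc q)"
        for es and a :: "_ \<Rightarrow> 'a"
        using eq that walks_mono[OF D(1)] unfolding rho_eq_iff_amble_sum[OF assms] by blast
      then show ?thesis
        using word_prod_UT_entry[OF D(2) \<psi>' D(3) pq] word_prod_UT_entry[OF D(2) \<psi>' D(4) pq] by simp
    qed
    ultimately show "?M u = ?M v"
      by (intro eq_matI) auto
  qed
next
  assume law: "is_law (UT TYPE('a) n) \<Sigma> u v"
  show "rho TYPE('a) n \<Sigma> u = rho TYPE('a) n \<Sigma> v"
    unfolding rho_eq_iff_amble_sum[OF assms]
  proof (intro allI ballI)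
    fix i j es and a :: "_ \<Rightarrow> 'a" assume es: "es \<in> walks n \<Sigma> i j"
    show "amble_sum u i es a = amble_sum v i es a"
      using amble_sum_eq_word_prod_UT_entry[OF es assms(1), of a]
        amble_sum_eq_word_prod_UT_entry[OF es assms(2), of a] law
      by (auto simp: is_law_def)
  qed
qed

text \<open>The empty path at the vertex 1, which exists because \<open>n \<ge> 1\<close>, has as coefficients in the
  images of distinct letters distinct variables, and these differ as functions since
  \<open>0 \<noteq> 1\<close>.\<close>
lemma inj_on_rho_letters:
  fixes \<Sigma> :: "'s set"
  assumes "n \<ge> 1"
  shows "inj_on (\<lambda>\<sigma>. rho TYPE('a :: comm_semiring_1) n \<Sigma> [\<sigma>]) \<Sigma>"
proof (rule inj_onI)
  fix \<sigma> \<tau> assume st: "\<sigma> \<in> \<Sigma>" "\<tau> \<in> \<Sigma>" "rho TYPE('a) n \<Sigma> [\<sigma>] = rho TYPE('a) n \<Sigma> [\<tau>]"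
  define a :: "'s \<times> nat \<Rightarrow> 'a" where "a = (\<lambda>x. if x = (\<sigma>, 1) then 1 else 0)"
  have "[] \<in> walks n \<Sigma> 1 1"
    using assms by (simp add: walks_Nil_iff)
  moreover have "\<forall>i j. \<forall>es\<in>walks n \<Sigma> i j. \<forall>a :: 's \<times> nat \<Rightarrow> 'a.
      amble_sum [\<sigma>] i es a = amble_sum [\<tau>] i es a"
    using iffD1[OF rho_eq_iff_amble_sum st(3)] st(1,2) by simp
  ultimately have "amble_sum [\<sigma>] 1 [] a = amble_sum [\<tau>] 1 [] a"
    by blast
  then show "\<sigma> = \<tau>"
    by (simp add: a_def split: if_splits)
qed

theorem theorem2p12:
  fixes n :: nat and \<Sigma> :: "'s set"
  assumes "n \<ge> 1"
  shows
    "submonoid (rho TYPE('a :: comm_semiring_1) n \<Sigma> ` carrier (free_monoid \<Sigma>))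
       (rho_algebra TYPE('a) n \<Sigma>) \<and>
     subsemigroup (rho TYPE('a) n \<Sigma> ` carrier (free_semigroup \<Sigma>))
       (rho_algebra TYPE('a) n \<Sigma>) \<and>
     inj_on (\<lambda>\<sigma>. rho TYPE('a) n \<Sigma> [\<sigma>]) \<Sigma> \<and>
     freely_generates_monoid TYPE('m) (UT TYPE('a) n)
       ((rho_algebra TYPE('a) n \<Sigma>)\<lparr>carrier := rho TYPE('a) n \<Sigma> ` carrier (free_monoid \<Sigma>)\<rparr>)
       \<Sigma> (\<lambda>\<sigma>. rho TYPE('a) n \<Sigma> [\<sigma>]) \<and>
     freely_generates_semigroup TYPE('m) (UT TYPE('a) n)
       ((rho_algebra TYPE('a) n \<Sigma>)\<lparr>carrier := rho TYPE('a) n \<Sigma> ` carrier (free_semigroup \<Sigma>)\<rparr>)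
       \<Sigma> (\<lambda>\<sigma>. rho TYPE('a) n \<Sigma> [\<sigma>])"
proof (intro conjI)
  have carriers: "carrier (free_monoid \<Sigma>) = lists \<Sigma>" "carrier (free_semigroup \<Sigma>) = lists \<Sigma> - {[]}"
    by (simp_all add: free_monoid_def free_semigroup_def)
  show "submonoid (rho TYPE('a) n \<Sigma> ` carrier (free_monoid \<Sigma>)) (rho_algebra TYPE('a) n \<Sigma>)"
    unfolding carriers
    by (rule submonoid.intro) (auto simp: rho_closed rho_append rho_Nil[symmetric])
  show "subsemigroup (rho TYPE('a) n \<Sigma> ` carrier (free_semigroup \<Sigma>)) (rho_algebra TYPE('a) n \<Sigma>)"
    unfolding carriers subsemigroup_def by (auto simp: rho_closed rho_append)
  show "inj_on (\<lambda>\<sigma>. rho TYPE('a) n \<Sigma> [\<sigma>]) \<Sigma>"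
    using assms by (rule inj_on_rho_letters)
  show "freely_generates_monoid TYPE('m) (UT TYPE('a) n)
       ((rho_algebra TYPE('a) n \<Sigma>)\<lparr>carrier := rho TYPE('a) n \<Sigma> ` carrier (free_monoid \<Sigma>)\<rparr>)
       \<Sigma> (\<lambda>\<sigma>. rho TYPE('a) n \<Sigma> [\<sigma>])"
    by (rule freely_generates_monoid_if_kernel_is_laws[OF monoid_UT])
      (simp_all add: carriers rho_append rho_Nil rho_eq_iff_law_of_UT)
  show "freely_generates_semigroup TYPE('m) (UT TYPE('a) n)
       ((rho_algebra TYPE('a) n \<Sigma>)\<lparr>carrier := rho TYPE('a) n \<Sigma> ` carrier (free_semigroup \<Sigma>)\<rparr>)
       \<Sigma> (\<lambda>\<sigma>. rho TYPE('a) n \<Sigma> [\<sigma>])"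
    by (rule freely_generates_semigroup_if_kernel_is_laws[OF monoid_UT])
      (simp_all add: carriers rho_append rho_eq_iff_law_of_UT)
qed

end
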